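(* Let $\mathcal{H}$ be a complex Hilbert space and let $T\in\mathcal{B}(\mathcal{H})$ be such that $T^*T\le T^{*2}T^2=T^{*3}T^3$ and $T^*T\,\mathcal{N}(T^* )\subset\mathcal{N}(T^* )$. Then there exists an invertible operator $A\in\mathcal{B}(\mathcal{H})$ with $T^*T\le T^*AT\le A$ such that $\mathcal{R}(A-T^*T)=\mathcal{R}(A-T^*AT)$ and this range is closed; hence $T$ admits a natural quasi-isometric lifting which is similar to an isometry.
   Context: $\mathcal{B}(\mathcal{H})$ is the algebra of bounded operators on $\mathcal{H}$; $\mathcal{R}(X)$, $\mathcal{N}(X)$ are the range and kernel of $X$; $B\le C$ means $C-B$ is positive. When $\mathcal{K}\supset\mathcal{H}$ is a Hilbert space containing $\mathcal{H}$ as a closed subspace and $P_{\mathcal{K},\mathcal{H}}:\mathcal{K}\to\mathcal{H}$ is the orthogonal projection, $S\in\mathcal{B}(\mathcal{K})$ is a lifting for $T$ if $P_{\mathcal{K},\mathcal{H}}S=TP_{\mathcal{K},\mathcal{H}}$. $S$ is a quasi-isometry (quasi-isometric) if $S^{*2}S^2=S^*S$. A natural quasi-isometric lifting for $T$ is a quasi-isometric lifting $S$ on some $\mathcal{K}\supset\mathcal{H}$ such that $S^*S\mathcal{H}\subset\mathcal{H}$ and $\mathcal{K}$ is the closed linear span of $\bigcup_{n\ge0}S^n\mathcal{H}$. *)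

theory Defs
  imports "HOL-Analysis.Analysis"
begin

section \<open>Complex Hilbert spaces\<close>

text \<open>The norm, the metric and completeness come from the class \<^class>\<open>banach\<close>; the last axiom says that the
  norm is induced by the inner product (hence the inner product is positive definite). The inner
  product is linear in its first argument.\<close>

class complex_hilbert = banach +
  fixes scaleC :: "complex \<Rightarrow> 'a \<Rightarrow> 'a"  (infixr \<open>*\<^sub>C\<close> 75)
    and cinner :: "'a \<Rightarrow> 'a \<Rightarrow> complex"
  assumes scaleC_add_right: "c *\<^sub>C (x + y) = c *\<^sub>C x + c *\<^sub>C y"
    and scaleC_add_left: "(c + d) *\<^sub>C x = c *\<^sub>C x + d *\<^sub>C x"
    and scaleC_scaleC: "c *\<^sub>C d *\<^sub>C x = (c * d) *\<^sub>C x"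
    and scaleC_of_real: "complex_of_real r *\<^sub>C x = r *\<^sub>R x"
    and cinner_commute: "cinner x y = cnj (cinner y x)"
    and cinner_add_left: "cinner (x + y) z = cinner x z + cinner y z"
    and cinner_scaleC_left: "cinner (c *\<^sub>C x) y = c * cinner x y"
    and cinner_self: "cinner x x = complex_of_real ((norm x)\<^sup>2)"


section \<open>Operators on closed subspaces\<close>

text \<open>The Hilbert space \<open>\<H>\<close> of the theorem is a type of class \<^class>\<open>complex_hilbert\<close>, whereas the space \<open>\<K>\<close>
  of a lifting depends on \<open>T\<close> and is therefore a closed subspace of such a type. An operator on a
  closed subspace \<open>X\<close> is represented by a total function of which only the values on \<open>X\<close> matter.\<close>

definition closed_csubspace :: "'a::complex_hilbert set \<Rightarrow> bool" where
  "closed_csubspace X \<longleftrightarrow>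
     0 \<in> X \<and> (\<forall>x\<in>X. \<forall>y\<in>X. x + y \<in> X) \<and> (\<forall>c. \<forall>x\<in>X. c *\<^sub>C x \<in> X) \<and> closed X"

definition bounded_op_on :: "'a::complex_hilbert set \<Rightarrow> ('a \<Rightarrow> 'a) \<Rightarrow> bool" where
  "bounded_op_on X S \<longleftrightarrow>
     (\<forall>x\<in>X. S x \<in> X) \<and>
     (\<forall>x\<in>X. \<forall>y\<in>X. S (x + y) = S x + S y) \<and>
     (\<forall>c. \<forall>x\<in>X. S (c *\<^sub>C x) = c *\<^sub>C S x) \<and>
     (\<exists>M. \<forall>x\<in>X. norm (S x) \<le> M * norm x)"

abbreviation bounded_op :: "('a::complex_hilbert \<Rightarrow> 'a) \<Rightarrow> bool" where
  "bounded_op \<equiv> bounded_op_on UNIV"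

text \<open>For a bounded operator \<open>S\<close> on a closed subspace \<open>X\<close> and \<open>y \<in> X\<close>, the vector described here
  exists and is unique by the Riesz representation theorem.\<close>

definition adj_on :: "'a::complex_hilbert set \<Rightarrow> ('a \<Rightarrow> 'a) \<Rightarrow> 'a \<Rightarrow> 'a" where
  "adj_on X S y = (THE z. z \<in> X \<and> (\<forall>x\<in>X. cinner (S x) y = cinner x z))"

abbreviation adj :: "('a::complex_hilbert \<Rightarrow> 'a) \<Rightarrow> 'a \<Rightarrow> 'a" where
  "adj \<equiv> adj_on UNIV"

definition invertible_op_on :: "'a::complex_hilbert set \<Rightarrow> ('a \<Rightarrow> 'a) \<Rightarrow> bool" where
  "invertible_op_on X A \<longleftrightarrow>
     bounded_op_on X A \<and> (\<exists>B. bounded_op_on X B \<and> (\<forall>x\<in>X. A (B x) = x \<and> B (A x) = x))"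

abbreviation invertible_op :: "('a::complex_hilbert \<Rightarrow> 'a) \<Rightarrow> bool" where
  "invertible_op \<equiv> invertible_op_on UNIV"

definition positive_op :: "('a::complex_hilbert \<Rightarrow> 'a) \<Rightarrow> bool" where
  "positive_op A \<longleftrightarrow> (\<forall>x. cinner (A x) x \<in> \<real>\<^sub>\<ge>\<^sub>0)"

definition op_le :: "('a::complex_hilbert \<Rightarrow> 'a) \<Rightarrow> ('a \<Rightarrow> 'a) \<Rightarrow> bool"  (infix \<open>\<le>\<^sub>o\<^sub>p\<close> 50) where
  "B \<le>\<^sub>o\<^sub>p C \<longleftrightarrow> positive_op (\<lambda>x. C x - B x)"

definition op_kernel :: "('a::complex_hilbert \<Rightarrow> 'a) \<Rightarrow> 'a set" where
  "op_kernel A = {x. A x = 0}"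

definition quasi_isometric_on :: "'a::complex_hilbert set \<Rightarrow> ('a \<Rightarrow> 'a) \<Rightarrow> bool" where
  "quasi_isometric_on X S \<longleftrightarrow>
     bounded_op_on X S \<and> (\<forall>x\<in>X. (adj_on X S ^^ 2) ((S ^^ 2) x) = adj_on X S (S x))"

definition isometric_on :: "'a::complex_hilbert set \<Rightarrow> ('a \<Rightarrow> 'a) \<Rightarrow> bool" where
  "isometric_on X W \<longleftrightarrow> bounded_op_on X W \<and> (\<forall>x\<in>X. norm (W x) = norm x)"

text \<open>The isometry may be taken on \<open>X\<close> itself: linearly homeomorphic Hilbert spaces are unitarily
  equivalent.\<close>

definition similar_to_isometry_on :: "'a::complex_hilbert set \<Rightarrow> ('a \<Rightarrow> 'a) \<Rightarrow> bool" where
  "similar_to_isometry_on X S \<longleftrightarrow>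
     (\<exists>W L. isometric_on X W \<and> invertible_op_on X L \<and> (\<forall>x\<in>X. L (S x) = W (L x)))"


section \<open>Liftings\<close>

text \<open>The inclusion \<open>\<H> \<subset> \<K>\<close> is a linear isometry \<open>V\<close> from \<open>\<H>\<close> into \<open>\<K>\<close> (its range is closed because
  \<open>\<H>\<close> is complete).\<close>

definition isometric_embedding :: "('a::complex_hilbert \<Rightarrow> 'b::complex_hilbert) \<Rightarrow> 'b set \<Rightarrow> bool" where
  "isometric_embedding V K \<longleftrightarrow>
     (\<forall>x y. V (x + y) = V x + V y) \<and> (\<forall>c x. V (c *\<^sub>C x) = c *\<^sub>C V x) \<and>
     (\<forall>x. norm (V x) = norm x) \<and> range V \<subseteq> K"

text \<open>The orthogonal projection onto \<open>\<H>\<close>, as a map with values in \<open>\<H>\<close>: the vector \<open>h\<close> such that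
  \<open>k - V h\<close> is orthogonal to \<open>V \<H>\<close>.\<close>

definition proj :: "('a::complex_hilbert \<Rightarrow> 'b::complex_hilbert) \<Rightarrow> 'b \<Rightarrow> 'a" where
  "proj V k = (THE h. \<forall>x. cinner (k - V h) (V x) = 0)"

definition lifting ::
    "('a::complex_hilbert \<Rightarrow> 'b::complex_hilbert) \<Rightarrow> 'b set \<Rightarrow> ('b \<Rightarrow> 'b) \<Rightarrow> ('a \<Rightarrow> 'a) \<Rightarrow> bool" where
  "lifting V K S T \<longleftrightarrow>
     closed_csubspace K \<and> isometric_embedding V K \<and> bounded_op_on K S \<and>
     (\<forall>k\<in>K. proj V (S k) = T (proj V k))"

definition natural_quasi_isometric_lifting ::
    "('a::complex_hilbert \<Rightarrow> 'b::complex_hilbert) \<Rightarrow> 'b set \<Rightarrow> ('b \<Rightarrow> 'b) \<Rightarrow> ('a \<Rightarrow> 'a) \<Rightarrow> bool" where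
  "natural_quasi_isometric_lifting V K S T \<longleftrightarrow>
     lifting V K S T \<and> quasi_isometric_on K S \<and>
     (\<lambda>k. adj_on K S (S k)) ` range V \<subseteq> range V \<and>
     K = closed_csubspace hull (\<Union>n. (S ^^ n) ` range V)"


section \<open>An ambient space for liftings\<close>

text \<open>The Hilbert space of square-summable sequences in \<open>\<H>\<close>. If \<open>\<K>\<close> is the closed linear span of
  the sets \<open>S\<^sup>n \<H>\<close>, then its Hilbert dimension is at most \<open>\<aleph>\<^sub>0 \<cdot> dim \<H>\<close>, so \<open>\<K>\<close> is unitarily equivalent
  to a closed subspace of \<open>\<H> ell2\<close>. Hence quantifying over the closed subspaces of \<open>\<H> ell2\<close> amounts
  to quantifying over all Hilbert spaces \<open>\<K>\<close> that can carry a natural lifting.\<close>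

typedef (overloaded) 'a ell2 = "{f :: nat \<Rightarrow> 'a::complex_hilbert. summable (\<lambda>n. (norm (f n))\<^sup>2)}"
  morphisms ell2_nth Abs_ell2
  by (rule exI[of _ "\<lambda>_. 0"]) simp

setup_lifting type_definition_ell2

lemma ell2_bounded:
  assumes "\<And>N. L2_set (\<lambda>n. norm (f n :: 'a::complex_hilbert)) {..<N} \<le> B"
  shows "summable (\<lambda>n. (norm (f n))\<^sup>2)" "sqrt (\<Sum>n. (norm (f n))\<^sup>2) \<le> B"
proof -
  have B: "0 \<le> B" using assms[of 0] by simp
  have le: "(\<Sum>n<N. (norm (f n))\<^sup>2) \<le> B\<^sup>2" for N
    using assms[of N] unfolding L2_set_def
    by (metis real_sqrt_le_iff real_sqrt_pow2_iff sqrt_le_D)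
  show s: "summable (\<lambda>n. (norm (f n))\<^sup>2)"
    by (rule bounded_imp_summable[where B="B\<^sup>2"])
       (auto intro: le[of "Suc _", unfolded lessThan_Suc_atMost])
  show "sqrt (\<Sum>n. (norm (f n))\<^sup>2) \<le> B"
    using suminf_le_const[OF s le] B by (simp add: real_le_lsqrt)
qed

lemma ell2_L2_set_le:
  assumes "summable (\<lambda>n. (norm (f n :: 'a::complex_hilbert))\<^sup>2)"
  shows "L2_set (\<lambda>n. norm (f n)) {..<N} \<le> sqrt (\<Sum>n. (norm (f n))\<^sup>2)"
  unfolding L2_set_def by (intro real_sqrt_le_mono sum_le_suminf assms) auto

lemma ell2_add:
  assumes "summable (\<lambda>n. (norm (f n :: 'a::complex_hilbert))\<^sup>2)" "summable (\<lambda>n. (norm (g n))\<^sup>2)"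
  shows "summable (\<lambda>n. (norm (f n + g n))\<^sup>2)"
    "sqrt (\<Sum>n. (norm (f n + g n))\<^sup>2) \<le> sqrt (\<Sum>n. (norm (f n))\<^sup>2) + sqrt (\<Sum>n. (norm (g n))\<^sup>2)"
proof -
  have "L2_set (\<lambda>n. norm (f n + g n)) {..<N}
      \<le> sqrt (\<Sum>n. (norm (f n))\<^sup>2) + sqrt (\<Sum>n. (norm (g n))\<^sup>2)" for N
  proof -
    have "L2_set (\<lambda>n. norm (f n + g n)) {..<N} \<le> L2_set (\<lambda>n. norm (f n) + norm (g n)) {..<N}"
      by (intro L2_set_mono norm_triangle_ineq norm_ge_zero)
    also have "\<dots> \<le> L2_set (\<lambda>n. norm (f n)) {..<N} + L2_set (\<lambda>n. norm (g n)) {..<N}"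
      by (rule L2_set_triangle_ineq)
    also have "\<dots> \<le> sqrt (\<Sum>n. (norm (f n))\<^sup>2) + sqrt (\<Sum>n. (norm (g n))\<^sup>2)"
      by (intro add_mono ell2_L2_set_le assms)
    finally show ?thesis .
  qed
  from ell2_bounded[OF this]
  show "summable (\<lambda>n. (norm (f n + g n))\<^sup>2)"
    "sqrt (\<Sum>n. (norm (f n + g n))\<^sup>2) \<le> sqrt (\<Sum>n. (norm (f n))\<^sup>2) + sqrt (\<Sum>n. (norm (g n))\<^sup>2)"
    by blast+
qed

lemma norm_scaleC: "norm (c *\<^sub>C (x::'a::complex_hilbert)) = cmod c * norm x"
proof -
  have "complex_of_real ((norm (c *\<^sub>C x))\<^sup>2) = c * cnj c * complex_of_real ((norm x)\<^sup>2)"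
    by (metis cinner_self cinner_scaleC_left cinner_commute complex_cnj_mult mult.assoc mult.commute
        complex_cnj_complex_of_real)
  also have "\<dots> = complex_of_real ((cmod c * norm x)\<^sup>2)"
    by (simp add: complex_norm_square[symmetric] power_mult_distrib)
  finally have "(norm (c *\<^sub>C x))\<^sup>2 = (cmod c * norm x)\<^sup>2"
    using of_real_eq_iff by blast
  then show ?thesis by (simp add: power2_eq_iff_nonneg)
qed

instantiation ell2 :: (complex_hilbert) real_normed_vector
begin

lift_definition zero_ell2 :: "'a ell2" is "\<lambda>_. 0" by simp
lift_definition plus_ell2 :: "'a ell2 \<Rightarrow> 'a ell2 \<Rightarrow> 'a ell2" is "\<lambda>f g n. f n + g n"
  by (rule ell2_add)
lift_definition uminus_ell2 :: "'a ell2 \<Rightarrow> 'a ell2" is "\<lambda>f n. - f n" by simp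
lift_definition minus_ell2 :: "'a ell2 \<Rightarrow> 'a ell2 \<Rightarrow> 'a ell2" is "\<lambda>f g n. f n - g n"
  using ell2_add(1)[of _ "\<lambda>n. - _ n"] by simp
lift_definition scaleR_ell2 :: "real \<Rightarrow> 'a ell2 \<Rightarrow> 'a ell2" is "\<lambda>r f n. r *\<^sub>R f n"
  by (simp add: power_mult_distrib summable_mult)
lift_definition norm_ell2 :: "'a ell2 \<Rightarrow> real" is "\<lambda>f. sqrt (\<Sum>n. (norm (f n))\<^sup>2)" .

definition dist_ell2 :: "'a ell2 \<Rightarrow> 'a ell2 \<Rightarrow> real" where "dist_ell2 f g = norm (f - g)"
definition sgn_ell2 :: "'a ell2 \<Rightarrow> 'a ell2" where "sgn_ell2 f = scaleR (inverse (norm f)) f"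
definition uniformity_ell2 :: "('a ell2 \<times> 'a ell2) filter" where
  "uniformity_ell2 = (INF e\<in>{0<..}. principal {(f, g). dist f g < e})"
definition open_ell2 :: "'a ell2 set \<Rightarrow> bool" where
  "open_ell2 U \<longleftrightarrow> (\<forall>f\<in>U. eventually (\<lambda>(f', g). f' = f \<longrightarrow> g \<in> U) uniformity)"

instance
proof
  fix f g h :: "'a ell2" and r s :: real
  show "f + g + h = f + (g + h)" by transfer (simp add: add.assoc)
  show "f + g = g + f" by transfer (simp add: add.commute)
  show "0 + f = f" by transfer simp
  show "- f + f = 0" by transfer simp
  show "f - g = f + - g" by transfer simp
  show "r *\<^sub>R (f + g) = r *\<^sub>R f + r *\<^sub>R g" by transfer (simp add: scaleR_add_right)
  show "(r + s) *\<^sub>R f = r *\<^sub>R f + s *\<^sub>R f" by transfer (simp add: scaleR_add_left)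
  show "r *\<^sub>R s *\<^sub>R f = (r * s) *\<^sub>R f" by transfer simp
  show "1 *\<^sub>R f = f" by transfer simp
  show "norm f = 0 \<longleftrightarrow> f = 0"
    by transfer (simp add: suminf_eq_zero_iff fun_eq_iff)
  show "norm (f + g) \<le> norm f + norm g" by transfer (rule ell2_add)
  show "norm (r *\<^sub>R f) = \<bar>r\<bar> * norm f"
    by transfer (simp add: power_mult_distrib suminf_mult real_sqrt_mult)
qed (simp_all add: dist_ell2_def sgn_ell2_def uniformity_ell2_def open_ell2_def)

end

lemma ell2_L2_set_le_norm: "L2_set (\<lambda>n. norm (ell2_nth f n)) {..<N} \<le> norm f"
  by transfer (rule ell2_L2_set_le)

lemma norm_ell2_nth_le: "norm (ell2_nth f n) \<le> norm f"
proof -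
  have "norm (ell2_nth f n) \<le> L2_set (\<lambda>n. norm (ell2_nth f n)) {..<Suc n}"
    by (intro member_le_L2_set) auto
  then show ?thesis using ell2_L2_set_le_norm order_trans by blast
qed

instance ell2 :: (complex_hilbert) banach
proof
  fix X :: "nat \<Rightarrow> 'a ell2"
  assume X: "Cauchy X"
  have "Cauchy (\<lambda>m. ell2_nth (X m) n)" for n
  proof (rule CauchyI)
    fix e :: real assume "0 < e"
    then obtain M where "\<forall>m\<ge>M. \<forall>k\<ge>M. norm (X m - X k) < e" using X by (blast dest: CauchyD)
    moreover have "norm (ell2_nth (X m) n - ell2_nth (X k) n) \<le> norm (X m - X k)" for m k
      using norm_ell2_nth_le[of "X m - X k" n] by (simp add: minus_ell2.rep_eq)
    ultimately show "\<exists>M. \<forall>m\<ge>M. \<forall>k\<ge>M. norm (ell2_nth (X m) n - ell2_nth (X k) n) < e"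
      by (meson le_less_trans)
  qed
  then have "\<forall>n. \<exists>l. (\<lambda>m. ell2_nth (X m) n) \<longlonglongrightarrow> l"
    by (simp add: Cauchy_convergent_iff convergent_def)
  then obtain l where l: "\<And>n. (\<lambda>m. ell2_nth (X m) n) \<longlonglongrightarrow> l n" by metis
  have bd: "L2_set (\<lambda>n. norm (ell2_nth (X m) n - l n)) {..<N} \<le> e"
    if M: "\<forall>m\<ge>M. \<forall>k\<ge>M. norm (X m - X k) < e" and m: "m \<ge> M" for M m N and e :: real
  proof (rule LIMSEQ_le_const2)
    show "(\<lambda>k. L2_set (\<lambda>n. norm (ell2_nth (X m) n - ell2_nth (X k) n)) {..<N})
        \<longlonglongrightarrow> L2_set (\<lambda>n. norm (ell2_nth (X m) n - l n)) {..<N}"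
      unfolding L2_set_def by (intro tendsto_intros l)
    have "L2_set (\<lambda>n. norm (ell2_nth (X m) n - ell2_nth (X k) n)) {..<N} \<le> e" if "k \<ge> M" for k
      using ell2_L2_set_le_norm[of "X m - X k" N] M m that
      by (fastforce simp: minus_ell2.rep_eq)
    then show "\<exists>K. \<forall>k\<ge>K. L2_set (\<lambda>n. norm (ell2_nth (X m) n - ell2_nth (X k) n)) {..<N} \<le> e"
      by blast
  qed
  obtain M1 where M1: "\<forall>m\<ge>M1. \<forall>k\<ge>M1. norm (X m - X k) < 1"
    using CauchyD[OF X, of 1] by auto
  have "summable (\<lambda>n. (norm (ell2_nth (X M1) n - l n))\<^sup>2)"
    by (rule ell2_bounded[OF bd[OF M1]]) simp
  then have "summable (\<lambda>n. (norm (l n - ell2_nth (X M1) n))\<^sup>2)" by (simp add: norm_minus_commute)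
  from ell2_add(1)[OF this, of "ell2_nth (X M1)"]
  have sl: "summable (\<lambda>n. (norm (l n))\<^sup>2)" using ell2_nth[of "X M1"] by simp
  define L where "L = Abs_ell2 l"
  have L: "ell2_nth L = l" unfolding L_def by (rule Abs_ell2_inverse) (use sl in simp)
  have "X \<longlonglongrightarrow> L"
  proof (rule LIMSEQ_I)
    fix e :: real assume "0 < e"
    then obtain M where M: "\<forall>m\<ge>M. \<forall>k\<ge>M. norm (X m - X k) < e / 2"
      using CauchyD[OF X, of "e / 2"] by auto
    have "norm (X m - L) \<le> e / 2" if "m \<ge> M" for m
      using ell2_bounded(2)[OF bd[OF M that]] by (simp add: norm_ell2.rep_eq minus_ell2.rep_eq L)
    then show "\<exists>M. \<forall>m\<ge>M. norm (X m - L) < e" using \<open>0 < e\<close> by (intro exI[of _ M]) fastforce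
  qed
  then show "convergent X" by (auto simp: convergent_def)
qed

lemma cinner_bound: "cmod (cinner x (y::'a::complex_hilbert)) \<le> 2 * ((norm x)\<^sup>2 + (norm y)\<^sup>2)"
proof -
  have Re: "\<bar>Re (cinner u y)\<bar> \<le> (norm u)\<^sup>2 + (norm y)\<^sup>2" for u
  proof -
    have add_right: "cinner a (b + c) = cinner a b + cinner a c" for a b c :: 'a
      by (metis cinner_commute cinner_add_left complex_cnj_add)
    have sq: "(norm (v + y))\<^sup>2 = (norm v)\<^sup>2 + (norm y)\<^sup>2 + 2 * Re (cinner v y)" for v
    proof -
      have "cinner (v + y) (v + y) = cinner v v + cinner y y + (cinner v y + cnj (cinner v y))"
        by (simp add: cinner_add_left add_right cinner_commute[of y v])
      then have "complex_of_real ((norm (v + y))\<^sup>2)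
          = complex_of_real ((norm v)\<^sup>2 + (norm y)\<^sup>2 + 2 * Re (cinner v y))"
        by (simp add: cinner_self complex_add_cnj)
      then show ?thesis using of_real_eq_iff by blast
    qed
    have neg: "- u = (-1) *\<^sub>C u" using scaleC_of_real[of "-1" u] by simp
    have "Re (cinner (- u) y) = - Re (cinner u y)" unfolding neg by (simp add: cinner_scaleC_left)
    with sq[of u] sq[of "- u"]
      zero_le_power2[of "norm (u + y)"] zero_le_power2[of "norm (- u + y)"]
      zero_le_power2[of "norm u"] zero_le_power2[of "norm y"]
    show ?thesis unfolding norm_minus_cancel by linarith
  qed
  have "\<bar>Im (cinner x y)\<bar> = \<bar>Re (cinner (\<i> *\<^sub>C x) y)\<bar>" by (simp add: cinner_scaleC_left)
  also have "\<dots> \<le> (norm x)\<^sup>2 + (norm y)\<^sup>2" using Re[of "\<i> *\<^sub>C x"] by (simp add: norm_scaleC)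
  finally have Im: "\<bar>Im (cinner x y)\<bar> \<le> (norm x)\<^sup>2 + (norm y)\<^sup>2" .
  from order_trans[OF cmod_le add_mono[OF Re[of x] Im]] show ?thesis by simp
qed

lemma ell2_cinner_summable:
  assumes "summable (\<lambda>n. (norm (f n :: 'a::complex_hilbert))\<^sup>2)" "summable (\<lambda>n. (norm (g n))\<^sup>2)"
  shows "summable (\<lambda>n. cinner (f n) (g n))"
  by (rule summable_comparison_test'[where g="\<lambda>n. 2 * ((norm (f n))\<^sup>2 + (norm (g n))\<^sup>2)" and N=0])
     (intro summable_mult summable_add assms cinner_bound)+

instantiation ell2 :: (complex_hilbert) complex_hilbert
begin

lift_definition scaleC_ell2 :: "complex \<Rightarrow> 'a ell2 \<Rightarrow> 'a ell2" is "\<lambda>c f n. c *\<^sub>C f n"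
  by (simp add: norm_scaleC power_mult_distrib summable_mult)
lift_definition cinner_ell2 :: "'a ell2 \<Rightarrow> 'a ell2 \<Rightarrow> complex" is
  "\<lambda>f g. \<Sum>n. cinner (f n) (g n)" .

instance
proof
  fix f g h :: "'a ell2" and c d :: complex and r :: real
  show "c *\<^sub>C (f + g) = c *\<^sub>C f + c *\<^sub>C g" by transfer (simp add: scaleC_add_right)
  show "(c + d) *\<^sub>C f = c *\<^sub>C f + d *\<^sub>C f" by transfer (simp add: scaleC_add_left)
  show "c *\<^sub>C d *\<^sub>C f = (c * d) *\<^sub>C f" by transfer (simp add: scaleC_scaleC)
  show "complex_of_real r *\<^sub>C f = r *\<^sub>R f" by transfer (simp add: scaleC_of_real)
  show "cinner f g = cnj (cinner g f)"
  proof transfer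
    fix f g :: "nat \<Rightarrow> 'a"
    assume s: "summable (\<lambda>n. (norm (f n))\<^sup>2)" "summable (\<lambda>n. (norm (g n))\<^sup>2)"
    have "(\<lambda>n. cnj (cinner (g n) (f n))) sums cnj (\<Sum>n. cinner (g n) (f n))"
      unfolding sums_cnj by (rule summable_sums ell2_cinner_summable s)+
    then show "(\<Sum>n. cinner (f n) (g n)) = cnj (\<Sum>n. cinner (g n) (f n))"
      unfolding cinner_commute[of "g _", symmetric] cinner_commute[of "f _" "g _", symmetric]
      by (rule sums_unique[symmetric])
  qed
  show "cinner (f + g) h = cinner f h + cinner g h"
    by transfer (simp add: cinner_add_left suminf_add ell2_cinner_summable)
  show "cinner (c *\<^sub>C f) g = c * cinner f g"
    by transfer (simp add: cinner_scaleC_left suminf_mult ell2_cinner_summable)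
  show "cinner f f = complex_of_real ((norm f)\<^sup>2)"
    by transfer (simp add: cinner_self suminf_nonneg suminf_of_real)
qed

end

end

theory Submission
  imports Defs
begin

text \<open>Let \<open>N\<close> and \<open>P\<close> be the orthogonal projections onto the kernels of \<open>T\<^sup>*\<close> and of \<open>T\<^sup>*\<^sup>2\<close>, and put
  \<open>R = T\<^sup>2 N\<close>. Both assertions of the theorem come from the single operator
  \<open>A = T\<^sup>*T + P + R\<^sup>*R\<close>.

  On the closure of the range of \<open>T\<close>, which is the range of \<open>1 - N\<close>, the operator \<open>T\<close> is expansive,
  because \<open>T\<^sup>*T \<le> T\<^sup>*\<^sup>2T\<^sup>2\<close>; and on the closure of the range of \<open>T\<^sup>2\<close> it is isometric, because
  \<open>T\<^sup>*\<^sup>2T\<^sup>2 = T\<^sup>*\<^sup>3T\<^sup>3\<close>. As \<open>T\<^sup>*T - 1\<close> is positive on the former space (which it leaves invariant, by the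
  last hypothesis), a vector at which its quadratic form vanishes lies in its kernel. Hence
  \<open>T\<^sup>*T\<close> is the identity on the range of \<open>T\<^sup>2\<close> (\<open>adj_T_T_range_T_squared\<close>). Together with \<open>P T = T N\<close> and
  \<open>N T = 0\<close> this gives the key identity \<open>A - T\<^sup>*A T = P\<close> (\<open>cinner_A_T\<close>). Moreover
  \<open>A \<ge> 1\<close>, so that \<open>A\<close> is invertible and \<open>T\<^sup>*T \<le> T\<^sup>*A T\<close>; and \<open>A - T\<^sup>*T = P (1 + R\<^sup>*R)\<close> has the same range
  as \<open>P\<close>.

  For the lifting, write a square-summable sequence as \<open>f = (v, h, u, \<dots>)\<close>, identify \<open>h\<close> with
  \<open>(0, h, 0, \<dots>)\<close>, and put
  \<open>S (v, h, u, \<dots>) = (R h, T h, P h, u, \<dots>)\<close>. Then \<open>\<parallel>S f\<parallel>\<^sup>2 = \<langle>A h, h\<rangle> + \<parallel>(u, \<dots>)\<parallel>\<^sup>2\<close>, and the key identity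
  says precisely that \<open>\<parallel>S (S f)\<parallel> = \<parallel>S f\<parallel>\<close>. The operator \<open>S\<close> forgets \<open>v\<close>, but \<open>v = R u\<close> holds on the closed
  linear span \<open>\<K>\<close> of the spaces \<open>S\<^sup>n \<H>\<close>, so there \<open>S\<close> is bounded below. A quasi-isometry that is bounded
  below is similar to an isometry via \<open>(S\<^sup>*S)\<^bsup>1/2\<^esup>\<close> (\<open>bounded_below_similar_to_isometry\<close>).\<close>


section \<open>The inner product\<close>

lemma cinner_add_right: "cinner x (y + z) = cinner x y + cinner x (z::'a::complex_hilbert)"
  by (metis cinner_commute cinner_add_left complex_cnj_add)

lemma cinner_scaleC_right: "cinner x (c *\<^sub>C y) = cnj c * cinner x (y::'a::complex_hilbert)"
  by (metis cinner_commute cinner_scaleC_left complex_cnj_mult)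

lemma norm_add_squared:
  "(norm (x + y))\<^sup>2 = (norm x)\<^sup>2 + (norm y)\<^sup>2 + 2 * Re (cinner x (y::'a::complex_hilbert))"
proof -
  have "complex_of_real ((norm (x + y))\<^sup>2) = cinner x x + cinner y y + (cinner x y + cnj (cinner x y))"
    by (subst cinner_self[symmetric])
       (simp only: cinner_add_left cinner_add_right cinner_commute[of y x] add_ac)
  also have "\<dots> = complex_of_real ((norm x)\<^sup>2 + (norm y)\<^sup>2 + 2 * Re (cinner x y))"
    by (simp add: cinner_self complex_add_cnj)
  finally show ?thesis using of_real_eq_iff by blast
qed

text \<open>For a unimodular \<open>u\<close> that makes \<open>\<langle>u x, y\<rangle>\<close> real and nonnegative, the inequality is the square
  of the triangle inequality for \<open>u x + y\<close>.\<close>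

lemma cinner_Cauchy_Schwarz: "cmod (cinner x y) \<le> norm x * norm (y::'a::complex_hilbert)"
proof (cases "cinner x y = 0")
  case False
  define c where "c = cinner x y"
  define u where "u = cnj c / of_real (cmod c)"
  have u: "cmod u = 1" and uc: "u * c = of_real (cmod c)"
    using False complex_norm_square[of c]
    by (auto simp: u_def norm_divide power2_eq_square mult.commute[of "cnj _"] divide_simps simp flip: c_def)
  have "cmod c = Re (cinner (u *\<^sub>C x) y)"
    by (simp add: cinner_scaleC_left uc flip: c_def)
  moreover have "(norm (u *\<^sub>C x + y))\<^sup>2 \<le> (norm (u *\<^sub>C x) + norm y)\<^sup>2"
    by (intro power_mono norm_triangle_ineq) simp
  ultimately show ?thesis
    by (simp add: norm_add_squared power2_sum norm_scaleC u c_def)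
qed simp

interpretation cinner: bounded_bilinear "cinner :: 'a::complex_hilbert \<Rightarrow> 'a \<Rightarrow> complex"
proof
  fix x y z :: 'a and r :: real
  show "cinner (x + y) z = cinner x z + cinner y z" by (rule cinner_add_left)
  show "cinner x (y + z) = cinner x y + cinner x z" by (rule cinner_add_right)
  show "cinner (r *\<^sub>R x) y = r *\<^sub>R cinner x y"
    by (metis scaleC_of_real cinner_scaleC_left scaleR_conv_of_real)
  show "cinner x (r *\<^sub>R y) = r *\<^sub>R cinner x y"
    by (metis scaleC_of_real cinner_scaleC_right scaleR_conv_of_real complex_cnj_complex_of_real)
  show "\<exists>K. \<forall>a b::'a. norm (cinner a b) \<le> norm a * norm b * K"
    using cinner_Cauchy_Schwarz by (intro exI[of _ 1]) auto
qed

declare cinner.zero_left [simp] cinner.zero_right [simp]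

lemma norm_diff_squared:
  "(norm (x - y))\<^sup>2 = (norm x)\<^sup>2 + (norm y)\<^sup>2 - 2 * Re (cinner x (y::'a::complex_hilbert))"
  using norm_add_squared[of x "- y"] by (simp add: cinner.minus_right)

lemma cinner_self_eq_0 [simp]: "cinner x x = 0 \<longleftrightarrow> x = (0::'a::complex_hilbert)"
  by (simp add: cinner_self)

lemma Re_cinner_self: "Re (cinner x x) = (norm (x::'a::complex_hilbert))\<^sup>2"
  by (simp add: cinner_self)

lemma cinner_eq_0_commute: "cinner x y = 0 \<longleftrightarrow> cinner y (x::'a::complex_hilbert) = 0"
  by (metis cinner_commute complex_cnj_zero)

lemma cinner_ext: "(\<And>z. cinner x z = cinner y z) \<Longrightarrow> x = (y::'a::complex_hilbert)"
  by (metis cinner.diff_left cinner_self_eq_0 diff_self eq_iff_diff_eq_0)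

lemma scaleC_0_right [simp]: "c *\<^sub>C (0::'a::complex_hilbert) = 0"
  by (metis norm_scaleC norm_zero mult_zero_right norm_eq_zero)

lemma scaleC_diff_right: "c *\<^sub>C (x - y) = c *\<^sub>C x - c *\<^sub>C (y::'a::complex_hilbert)"
  by (metis add_diff_cancel diff_add_cancel scaleC_add_right)

lemma scaleC_scaleR: "c *\<^sub>C r *\<^sub>R x = r *\<^sub>R c *\<^sub>C (x::'a::complex_hilbert)"
  by (metis scaleC_of_real scaleC_scaleC mult.commute)

lemma bounded_linear_scaleC: "bounded_linear (\<lambda>x::'a::complex_hilbert. c *\<^sub>C x)"
  by (rule bounded_linear_intro[where K="cmod c"])
    (simp_all add: scaleC_add_right scaleC_scaleR norm_scaleC mult.commute)


section \<open>Orthogonal projections\<close>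

lemma closed_csubspaceD:
  assumes "closed_csubspace X"
  shows "0 \<in> X" "\<And>x y. x \<in> X \<Longrightarrow> y \<in> X \<Longrightarrow> x + y \<in> X" "\<And>x c. x \<in> X \<Longrightarrow> c *\<^sub>C x \<in> X"
    "\<And>x r. x \<in> X \<Longrightarrow> r *\<^sub>R x \<in> X" "\<And>x y. x \<in> X \<Longrightarrow> y \<in> X \<Longrightarrow> x - y \<in> X"
    "closed X" "subspace X"
proof -
  show 0: "0 \<in> X" and a: "\<And>x y. x \<in> X \<Longrightarrow> y \<in> X \<Longrightarrow> x + y \<in> X"
    and c: "\<And>x c. x \<in> X \<Longrightarrow> c *\<^sub>C x \<in> X" and "closed X"
    using assms by (auto simp: closed_csubspace_def)
  show r: "\<And>x r. x \<in> X \<Longrightarrow> r *\<^sub>R x \<in> X" using c by (metis scaleC_of_real)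
  show "subspace X" using 0 a r by (simp add: subspace_def)
  then show "\<And>x y. x \<in> X \<Longrightarrow> y \<in> X \<Longrightarrow> x - y \<in> X" by (rule subspace_diff)
qed

lemma closed_csubspace_UNIV [simp]: "closed_csubspace UNIV"
  by (simp add: closed_csubspace_def)

lemma parallelogram_law:
  "(norm (x + y))\<^sup>2 + (norm (x - y))\<^sup>2 = 2 * (norm x)\<^sup>2 + 2 * (norm (y::'a::complex_hilbert))\<^sup>2"
  by (simp add: norm_add_squared norm_diff_squared)

text \<open>A minimising sequence of the distance is Cauchy: the midpoint of two of its terms lies in
  \<open>X\<close>, so it is not closer to \<open>x\<close> than the distance, and the parallelogram law bounds the
  difference of the two terms.\<close>

lemma closest_point_ex:
  assumes X: "closed_csubspace (X::'a::complex_hilbert set)"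
  shows "\<exists>p\<in>X. \<forall>y\<in>X. norm (x - p) \<le> norm (x - y)"
proof -
  note XD = closed_csubspaceD[OF X]
  define d where "d = infdist x X"
  have ne: "X \<noteq> {}" using XD(1) by auto
  have d0: "0 \<le> d" by (simp add: d_def infdist_nonneg)
  have dle: "d \<le> norm (x - y)" if "y \<in> X" for y
    using infdist_le[OF that, of x] by (simp add: d_def dist_norm)
  have "\<exists>y\<in>X. norm (x - y) < d + inverse (real (Suc n))" for n
  proof -
    have "(INF y\<in>X. dist x y) < d + inverse (real (Suc n))"
      using ne by (simp add: d_def infdist_notempty)
    moreover have "bdd_below (dist x ` X)" by (rule bdd_belowI2[where m=0]) simp
    ultimately show ?thesis by (simp add: cINF_less_iff ne dist_norm)
  qed
  then obtain f where f: "\<And>n. f n \<in> X" and fn: "\<And>n. norm (x - f n) < d + inverse (real (Suc n))"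
    by metis
  have near: "(norm (f m - f n))\<^sup>2 \<le> 4 * (2 * d + e) * e"
    if "inverse (real (Suc m)) \<le> e" "inverse (real (Suc n)) \<le> e" for m n e
  proof -
    have half: "(1/2) *\<^sub>R (f m + f n) \<in> X" by (intro XD f)
    have "(x - f m) + (x - f n) = 2 *\<^sub>R (x - (1/2) *\<^sub>R (f m + f n))"
      by (simp add: scaleR_2 algebra_simps flip: scaleR_add_left)
    then have "norm ((x - f m) + (x - f n)) \<ge> 2 * d"
      using dle[OF half] by simp
    then have "(2 * d)\<^sup>2 \<le> (norm ((x - f m) + (x - f n)))\<^sup>2"
      using d0 by (intro power_mono) auto
    moreover have "(norm (x - f k))\<^sup>2 \<le> (d + e)\<^sup>2" if "inverse (real (Suc k)) \<le> e" for k
      using fn[of k] that by (intro power_mono) auto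
    ultimately have "(norm ((x - f m) - (x - f n)))\<^sup>2 \<le> 4 * (d + e)\<^sup>2 - (2 * d)\<^sup>2"
      using parallelogram_law[of "x - f m" "x - f n"] that by (smt (verit))
    then show ?thesis by (simp add: norm_minus_commute power2_eq_square algebra_simps)
  qed
  have "Cauchy f"
  proof (rule CauchyI)
    fix e :: real assume e: "0 < e"
    have "((\<lambda>s. 4 * (2 * d + s) * s) \<longlongrightarrow> 4 * (2 * d + 0) * 0) (at_right 0)"
      by (intro tendsto_intros)
    then have "\<forall>\<^sub>F s in at_right 0. 4 * (2 * d + s) * s < e\<^sup>2"
      by (rule order_tendstoD) (use e in simp)
    then obtain s where s: "0 < s" "4 * (2 * d + s) * s < e\<^sup>2"
      unfolding eventually_at_right_field by (metis dense)
    obtain M where M: "inverse (real (Suc M)) < s" using reals_Archimedean[OF s(1)] by auto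
    have "norm (f m - f n) < e" if "m \<ge> M" "n \<ge> M" for m n
    proof -
      have "inverse (real (Suc k)) \<le> s" if "k \<ge> M" for k
        using M that le_imp_inverse_le[of "real (Suc M)" "real (Suc k)"] by linarith
      from near[OF this[OF that(1)] this[OF that(2)]] s(2) have "(norm (f m - f n))\<^sup>2 < e\<^sup>2" by simp
      then show ?thesis using e by (simp add: power_less_imp_less_base)
    qed
    then show "\<exists>M. \<forall>m\<ge>M. \<forall>n\<ge>M. norm (f m - f n) < e" by blast
  qed
  then obtain p where p: "f \<longlonglongrightarrow> p" by (auto simp: Cauchy_convergent_iff convergent_def)
  have "p \<in> X" using XD(6) f p by (metis closed_sequentially)
  moreover have "norm (x - p) \<le> d"
  proof (rule LIMSEQ_le)
    show "(\<lambda>n. norm (x - f n)) \<longlonglongrightarrow> norm (x - p)" by (intro tendsto_intros p)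
    show "(\<lambda>n. d + inverse (real (Suc n))) \<longlonglongrightarrow> d"
      using tendsto_add[OF tendsto_const LIMSEQ_inverse_real_of_nat] by simp
    show "\<exists>N. \<forall>n\<ge>N. norm (x - f n) \<le> d + inverse (real (Suc n))" using fn less_imp_le by blast
  qed
  ultimately show ?thesis using dle order_trans by blast
qed

text \<open>If the closest point \<open>p\<close> left a component of \<open>x - p\<close> along some \<open>y \<in> X\<close>, then adding that
  component to \<open>p\<close> would come closer to \<open>x\<close>.\<close>

lemma orthogonal_decomposition:
  assumes X: "closed_csubspace (X::'a::complex_hilbert set)"
  shows "\<exists>p\<in>X. \<forall>y\<in>X. cinner (x - p) y = 0"
proof -
  note XD = closed_csubspaceD[OF X]
  obtain p where p: "p \<in> X" and min: "\<And>y. y \<in> X \<Longrightarrow> norm (x - p) \<le> norm (x - y)"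
    using closest_point_ex[OF X] by blast
  have "cinner (x - p) y = 0" if y: "y \<in> X" for y
  proof (rule ccontr)
    define c where "c = cinner (x - p) y"
    define s where "s = (norm y)\<^sup>2"
    assume "cinner (x - p) y \<noteq> 0"
    then have c: "c \<noteq> 0" and s: "s > 0" by (auto simp: c_def s_def)
    have "norm (x - p) \<le> norm (x - (p + (c / of_real s) *\<^sub>C y))" by (intro min XD p y)
    then have "(norm (x - p))\<^sup>2 \<le> (norm ((x - p) - (c / of_real s) *\<^sub>C y))\<^sup>2"
      by (simp add: diff_diff_add)
    also have "\<dots> = (norm (x - p))\<^sup>2 + (cmod c / s)\<^sup>2 * s - 2 * Re (cnj c * c / of_real s)"
      using s by (simp add: norm_diff_squared norm_scaleC cinner_scaleC_right c_def[symmetric]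
          s_def[symmetric] power_mult_distrib power_divide norm_divide)
    also have "Re (cnj c * c / of_real s) = (cmod c)\<^sup>2 / s"
      using s by (simp add: mult.commute[of "cnj c"] flip: complex_norm_square of_real_divide of_real_power)
    also have "(norm (x - p))\<^sup>2 + (cmod c / s)\<^sup>2 * s - 2 * ((cmod c)\<^sup>2 / s)
        = (norm (x - p))\<^sup>2 - (cmod c)\<^sup>2 / s"
      using s by (simp add: power2_eq_square field_simps)
    finally show False using c s by (simp add: divide_le_0_iff)
  qed
  with p show ?thesis by blast
qed

definition orth_proj :: "'a::complex_hilbert set \<Rightarrow> 'a \<Rightarrow> 'a" where
  "orth_proj X x = (SOME p. p \<in> X \<and> (\<forall>y\<in>X. cinner (x - p) y = 0))"

lemma
  assumes "closed_csubspace X"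
  shows orth_proj_in: "orth_proj X x \<in> X"
    and orth_proj_orth: "y \<in> X \<Longrightarrow> cinner (x - orth_proj X x) y = 0"
  using someI_ex[of "\<lambda>p. p \<in> X \<and> (\<forall>y\<in>X. cinner (x - p) y = 0)"] orthogonal_decomposition[OF assms, of x]
  unfolding orth_proj_def by blast+

lemma orth_proj_eqI:
  assumes X: "closed_csubspace X" and "p \<in> X" "\<And>y. y \<in> X \<Longrightarrow> cinner (x - p) y = 0"
  shows "orth_proj X x = p"
proof -
  define d where "d = orth_proj X x - p"
  have d: "d \<in> X" using assms(2) orth_proj_in[OF X] closed_csubspaceD(5)[OF X] by (simp add: d_def)
  have "cinner d d = cinner (x - p) d - cinner (x - orth_proj X x) d"
    by (simp add: d_def flip: cinner.diff_left)
  then have "d = 0" using assms(3)[OF d] orth_proj_orth[OF X d] by simp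
  then show ?thesis by (simp add: d_def)
qed

lemma orth_proj_fixes: "closed_csubspace X \<Longrightarrow> x \<in> X \<Longrightarrow> orth_proj X x = x"
  by (rule orth_proj_eqI) simp_all

lemma cinner_orth_proj:
  assumes "closed_csubspace X"
  shows "cinner (orth_proj X x) y = cinner (orth_proj X x) (orth_proj X y)"
    "cinner x (orth_proj X y) = cinner (orth_proj X x) (orth_proj X y)"
proof -
  show "cinner x (orth_proj X y) = cinner (orth_proj X x) (orth_proj X y)" for x y
    using orth_proj_orth[OF assms orth_proj_in[OF assms]] by (simp add: cinner.diff_left)
  then show "cinner (orth_proj X x) y = cinner (orth_proj X x) (orth_proj X y)"
    by (metis cinner_commute)
qed

lemma norm_orth_proj_decomp:
  assumes "closed_csubspace X"
  shows "(norm x)\<^sup>2 = (norm (orth_proj X x))\<^sup>2 + (norm (x - orth_proj X x))\<^sup>2"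
  using norm_add_squared[of "x - orth_proj X x" "orth_proj X x"]
    orth_proj_orth[OF assms orth_proj_in[OF assms], of x x] by simp

lemma norm_orth_proj_le: "closed_csubspace X \<Longrightarrow> norm (orth_proj X x) \<le> norm x"
  using norm_orth_proj_decomp[of X x] by (simp add: power2_le_imp_le)

lemma bounded_op_orth_proj:
  assumes X: "closed_csubspace X"
  shows "bounded_op (orth_proj X)"
proof -
  note XD = closed_csubspaceD[OF X]
  have "orth_proj X (x + y) = orth_proj X x + orth_proj X y" for x y
    using orth_proj_orth[OF X]
    by (intro orth_proj_eqI X XD orth_proj_in)
       (simp add: add_diff_add cinner.add_left)
  moreover have "orth_proj X (c *\<^sub>C x) = c *\<^sub>C orth_proj X x" for c x
    using orth_proj_orth[OF X]
    by (intro orth_proj_eqI X XD orth_proj_in)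
       (simp add: cinner_scaleC_left flip: scaleC_diff_right)
  ultimately show ?thesis
    unfolding bounded_op_on_def using norm_orth_proj_le[OF X]
    by (auto intro: exI[of _ 1])
qed


section \<open>Bounded operators and their adjoints\<close>

lemma bounded_op_iff_bounded_linear:
  "bounded_op T \<longleftrightarrow> bounded_linear T \<and> (\<forall>c x. T (c *\<^sub>C x) = c *\<^sub>C T x)"
proof
  assume T: "bounded_op T"
  then obtain M where M: "\<And>x. norm (T x) \<le> M * norm x" by (auto simp: bounded_op_on_def)
  have "bounded_linear T"
  proof (rule bounded_linear_intro[where K=M])
    show "T (r *\<^sub>R x) = r *\<^sub>R T x" for r x
      using T by (auto simp: bounded_op_on_def simp flip: scaleC_of_real)
  qed (use T M in \<open>auto simp: bounded_op_on_def mult.commute\<close>)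
  with T show "bounded_linear T \<and> (\<forall>c x. T (c *\<^sub>C x) = c *\<^sub>C T x)"
    by (simp add: bounded_op_on_def)
next
  assume T: "bounded_linear T \<and> (\<forall>c x. T (c *\<^sub>C x) = c *\<^sub>C T x)"
  then obtain M where "\<And>x. norm (T x) \<le> norm x * M" using bounded_linear.bounded by blast
  with T show "bounded_op T"
    by (auto simp: bounded_op_on_def bounded_linear.linear linear_add mult.commute intro!: exI[of _ M])
qed

lemma bounded_op_linear: "bounded_op T \<Longrightarrow> bounded_linear T"
  by (simp add: bounded_op_iff_bounded_linear)

lemma bounded_op_on_subset:
  "bounded_op S \<Longrightarrow> (\<And>x. x \<in> X \<Longrightarrow> S x \<in> X) \<Longrightarrow> bounded_op_on X S"
  by (auto simp: bounded_op_on_def)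

lemma bounded_op_on_bound:
  assumes "bounded_op_on X S"
  obtains M where "0 < M" "\<And>x. x \<in> X \<Longrightarrow> norm (S x) \<le> M * norm x"
proof -
  obtain M where M: "\<And>x. x \<in> X \<Longrightarrow> norm (S x) \<le> M * norm x"
    using assms unfolding bounded_op_on_def by blast
  show ?thesis
  proof (rule that[of "max M 1"])
    show "norm (S x) \<le> max M 1 * norm x" if "x \<in> X" for x
      using M[OF that] mult_right_mono[of M "max M 1" "norm x"] by simp
  qed simp
qed

lemma bounded_op_on_compose:
  assumes "bounded_op_on X S" "bounded_op_on X R"
  shows "bounded_op_on X (\<lambda>x. S (R x))"
proof -
  obtain M where M: "0 < M" "\<And>x. x \<in> X \<Longrightarrow> norm (S x) \<le> M * norm x"
    using bounded_op_on_bound[OF assms(1)] by blast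
  obtain N where N: "\<And>x. x \<in> X \<Longrightarrow> norm (R x) \<le> N * norm x"
    using bounded_op_on_bound[OF assms(2)] by metis
  have "norm (S (R x)) \<le> (M * N) * norm x" if "x \<in> X" for x
  proof -
    have "norm (S (R x)) \<le> M * norm (R x)" using M that assms(2) by (simp add: bounded_op_on_def)
    also have "\<dots> \<le> M * (N * norm x)" using M(1) N[OF that] by simp
    finally show ?thesis by simp
  qed
  then show ?thesis using assms by (auto simp: bounded_op_on_def)
qed

lemma bounded_op_id: "bounded_op (\<lambda>x. x)"
  by (simp add: bounded_op_iff_bounded_linear)

lemma bounded_op_add: "bounded_op S \<Longrightarrow> bounded_op R \<Longrightarrow> bounded_op (\<lambda>x. S x + R x)"
  by (simp add: bounded_op_iff_bounded_linear bounded_linear_add scaleC_add_right)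

lemma bounded_op_diff: "bounded_op S \<Longrightarrow> bounded_op R \<Longrightarrow> bounded_op (\<lambda>x. S x - R x)"
  by (simp add: bounded_op_iff_bounded_linear bounded_linear_sub scaleC_diff_right)

lemma bounded_op_scaleR: "bounded_op S \<Longrightarrow> bounded_op (\<lambda>x. r *\<^sub>R S x)"
  by (simp add: bounded_op_iff_bounded_linear bounded_linear_const_scaleR scaleC_scaleR)

text \<open>Precomposing with the orthogonal projection reduces facts about operators on a closed subspace
  to facts about operators on the whole space.\<close>

lemma bounded_op_compose_orth_proj:
  assumes "closed_csubspace X" "bounded_op_on X S"
  shows "bounded_op (\<lambda>x. S (orth_proj X x))"
proof -
  obtain M where M: "0 < M" "\<And>x. x \<in> X \<Longrightarrow> norm (S x) \<le> M * norm x"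
    using bounded_op_on_bound[OF assms(2)] by blast
  have "norm (S (orth_proj X x)) \<le> M * norm x" for x
    using M(2)[OF orth_proj_in[OF assms(1)]] mult_left_mono[OF norm_orth_proj_le[OF assms(1)], of M]
      M(1) by (meson less_imp_le order_trans)
  then show ?thesis
    using bounded_op_orth_proj[OF assms(1)] assms(2) orth_proj_in[OF assms(1)]
    by (auto simp: bounded_op_on_def)
qed

lemma closed_csubspace_eq_zero:
  assumes "bounded_linear f" "\<And>c x. f x = 0 \<Longrightarrow> f (c *\<^sub>C x) = 0"
  shows "closed_csubspace {x. f x = 0}"
  using assms unfolding closed_csubspace_def
  by (auto simp: bounded_linear.linear linear_0 linear_add
      intro!: closed_Collect_eq linear_continuous_on continuous_on_const)

lemma closed_csubspace_hull: "closed_csubspace (closed_csubspace hull B)"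
  by (rule hull_in) (auto simp: closed_csubspace_def)

lemma closed_csubspace_vimage:
  assumes S: "bounded_op S" and K: "closed_csubspace K"
  shows "closed_csubspace (S -` K)"
proof -
  note KD = closed_csubspaceD[OF K]
  have "S 0 = 0" by (rule linear_0[OF bounded_linear.linear[OF bounded_op_linear[OF S]]])
  moreover have "closed (S -` K)"
    by (intro closed_vimage KD(6) linear_continuous_on bounded_op_linear S)
  ultimately show ?thesis using S KD(1-3) by (simp add: closed_csubspace_def bounded_op_on_def)
qed

text \<open>The kernel has codimension at most one, so a vector orthogonal to it, suitably scaled,
  represents the functional.\<close>

lemma Riesz_representation:
  fixes \<phi> :: "'a::complex_hilbert \<Rightarrow> complex"
  assumes lin: "bounded_linear \<phi>" and sc: "\<And>c x. \<phi> (c *\<^sub>C x) = c * \<phi> x"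
  shows "\<exists>z. \<forall>x. \<phi> x = cinner x z"
proof (cases "\<forall>x. \<phi> x = 0")
  case True
  then show ?thesis by (intro exI[of _ 0]) simp
next
  case False
  define K where "K = {x. \<phi> x = 0}"
  have K: "closed_csubspace K" unfolding K_def
    by (rule closed_csubspace_eq_zero[OF lin]) (simp add: sc)
  interpret \<phi>: bounded_linear \<phi> by (rule lin)
  obtain v where "\<phi> v \<noteq> 0" using False by blast
  define u where "u = v - orth_proj K v"
  have "\<phi> (orth_proj K v) = 0" using orth_proj_in[OF K] by (auto simp: K_def)
  then have \<phi>u: "\<phi> u \<noteq> 0" using \<open>\<phi> v \<noteq> 0\<close> by (simp add: u_def \<phi>.diff)
  then have u: "u \<noteq> 0" using \<phi>.zero by auto
  have "\<phi> x = cinner x ((cnj (\<phi> u) / of_real ((norm u)\<^sup>2)) *\<^sub>C u)" for x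
  proof -
    have "\<phi> u *\<^sub>C x - \<phi> x *\<^sub>C u \<in> K" by (simp add: K_def \<phi>.diff sc)
    then have "cinner (\<phi> u *\<^sub>C x - \<phi> x *\<^sub>C u) u = 0"
      using orth_proj_orth[OF K] u_def cinner_eq_0_commute by metis
    then have "\<phi> u * cinner x u = \<phi> x * of_real ((norm u)\<^sup>2)"
      by (simp add: cinner.diff_left cinner_scaleC_left cinner_self)
    then show ?thesis using u by (simp add: cinner_scaleC_right field_simps)
  qed
  then show ?thesis by blast
qed

lemma adj_on_eqI:
  assumes "closed_csubspace X" "z \<in> X" "\<And>x. x \<in> X \<Longrightarrow> cinner (S x) y = cinner x z"
  shows "adj_on X S y = z"
  unfolding adj_on_def
proof (rule the_equality)
  fix z' assume z': "z' \<in> X \<and> (\<forall>x\<in>X. cinner (S x) y = cinner x z')"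
  then have "cinner (z' - z) (z' - z) = 0"
    using assms closed_csubspaceD(5)[OF assms(1)] by (metis cinner.diff_right diff_self)
  then show "z' = z" by simp
qed (use assms in auto)

lemma
  assumes X: "closed_csubspace X" and S: "bounded_op_on X S"
  shows adj_on_in: "adj_on X S y \<in> X"
    and cinner_adj_on: "x \<in> X \<Longrightarrow> cinner (S x) y = cinner x (adj_on X S y)"
proof -
  define \<phi> where "\<phi> x = cinner (S (orth_proj X x)) y" for x
  have b: "bounded_op (\<lambda>x. S (orth_proj X x))" by (rule bounded_op_compose_orth_proj[OF X S])
  have "bounded_linear \<phi>" unfolding \<phi>_def
    by (rule bounded_linear_compose[OF cinner.bounded_linear_left bounded_op_linear[OF b]])
  moreover have "\<phi> (c *\<^sub>C x) = c * \<phi> x" for c x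
    using b by (simp add: \<phi>_def bounded_op_iff_bounded_linear cinner_scaleC_left)
  ultimately obtain z where z: "\<And>x. \<phi> x = cinner x z" using Riesz_representation by metis
  have *: "cinner (S x) y = cinner x (orth_proj X z)" if "x \<in> X" for x
    using z[of x] that X by (simp add: \<phi>_def orth_proj_fixes) (metis cinner_orth_proj orth_proj_fixes)
  then have eq: "adj_on X S y = orth_proj X z" by (intro adj_on_eqI X orth_proj_in) auto
  show "adj_on X S y \<in> X" by (simp add: eq orth_proj_in X)
  show "x \<in> X \<Longrightarrow> cinner (S x) y = cinner x (adj_on X S y)" by (simp add: eq *)
qed

lemma cinner_adj: "bounded_op T \<Longrightarrow> cinner x (adj T y) = cinner (T x) y"
  using cinner_adj_on[of UNIV T x y] by simp

lemma cinner_adj_left: "bounded_op T \<Longrightarrow> cinner (adj T y) x = cinner y (T x)"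
  using cinner_adj cinner_commute by metis

lemma bounded_op_adj:
  assumes T: "bounded_op T"
  shows "bounded_op (adj T)"
proof -
  obtain M where M: "0 < M" "\<And>x. norm (T x) \<le> M * norm x"
    using bounded_op_on_bound[OF T] by auto
  have "norm (adj T y) \<le> M * norm y" for y
  proof (cases "adj T y = 0")
    case False
    have "(norm (adj T y))\<^sup>2 = cmod (cinner (T (adj T y)) y)"
      by (simp add: cinner_adj[OF T, symmetric] cinner_self norm_power)
    also have "\<dots> \<le> norm (T (adj T y)) * norm y" by (rule cinner_Cauchy_Schwarz)
    also have "\<dots> \<le> (M * norm (adj T y)) * norm y" by (intro mult_right_mono M) simp
    finally show ?thesis using False by (simp add: power2_eq_square mult.assoc mult.left_commute)
  qed (use M(1) in simp)
  moreover have "adj T (x + y) = adj T x + adj T y" for x y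
    by (rule cinner_ext) (simp add: cinner_adj_left[OF T] cinner.add_left)
  moreover have "adj T (c *\<^sub>C x) = c *\<^sub>C adj T x" for c x
    by (rule cinner_ext) (simp add: cinner_adj_left[OF T] cinner_scaleC_left)
  ultimately show ?thesis by (auto simp: bounded_op_on_def)
qed


section \<open>Inverting symmetric operators\<close>

text \<open>An operator that is bounded below is injective with complete range, and for a symmetric
  operator the orthogonal complement of the range is the kernel. So it is also surjective.\<close>

lemma invertible_op_on_symmetric:
  assumes X: "closed_csubspace X" and A: "bounded_op_on X A"
    and sym: "\<And>x y. x \<in> X \<Longrightarrow> y \<in> X \<Longrightarrow> cinner (A x) y = cinner x (A y)"
    and m: "0 < m" and below: "\<And>x. x \<in> X \<Longrightarrow> m * norm x \<le> norm (A x)"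
  shows "invertible_op_on X A"
proof -
  note XD = closed_csubspaceD[OF X]
  have A_in: "A x \<in> X" and A_add: "y \<in> X \<Longrightarrow> A (x + y) = A x + A y" and A_sc: "A (c *\<^sub>C x) = c *\<^sub>C A x"
    if "x \<in> X" for x y c using A that by (auto simp: bounded_op_on_def)
  have A_diff: "A (x - y) = A x - A y" if "x \<in> X" "y \<in> X" for x y
    using A_add[OF XD(5)[OF that] that(2)] by simp
  have inj: "x = y" if "x \<in> X" "y \<in> X" "A x = A y" for x y
    using below[OF XD(5)[OF that(1,2)]] m that by (simp add: A_diff mult_le_0_iff)
  have "complete ((\<lambda>x. A (orth_proj X x)) ` X)"
    by (rule complete_isometric_image[OF m XD(7)])
       (use bounded_op_linear[OF bounded_op_compose_orth_proj[OF X A]] below XD(6)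
         in \<open>auto simp: orth_proj_fixes[OF X] complete_eq_closed\<close>)
  also have "(\<lambda>x. A (orth_proj X x)) ` X = A ` X"
    by (intro image_cong) (simp_all add: orth_proj_fixes[OF X])
  finally have "closed (A ` X)" by (simp add: complete_eq_closed)
  moreover have "0 \<in> A ` X" using A_diff[OF XD(1) XD(1)] XD(1) by (intro image_eqI[of _ _ 0]) auto
  moreover have "A x + A y \<in> A ` X" if "x \<in> X" "y \<in> X" for x y
    using A_add[OF that] XD(2)[OF that] by (metis imageI)
  moreover have "c *\<^sub>C A x \<in> A ` X" if "x \<in> X" for c x
    using A_sc[OF that] XD(3)[OF that] by (metis imageI)
  ultimately have R: "closed_csubspace (A ` X)"
    unfolding closed_csubspace_def by (simp add: ball_simps)
  have surj: "y \<in> A ` X" if y: "y \<in> X" for y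
  proof -
    define r where "r = y - orth_proj (A ` X) y"
    have "A ` X \<subseteq> X" using A_in by (simp add: image_subset_iff)
    then have "orth_proj (A ` X) y \<in> X" using orth_proj_in[OF R] by (rule subsetD)
    then have r: "r \<in> X" using y XD by (simp add: r_def)
    have "cinner r (A (A r)) = 0" using orth_proj_orth[OF R] A_in r by (simp add: r_def)
    then have "A r = 0" using sym[OF r A_in[OF r]] by simp
    then have "r = 0" using below[OF r] m by (simp add: mult_le_0_iff)
    then show ?thesis using orth_proj_in[OF R, of y] by (simp add: r_def)
  qed
  define B where "B = inv_into X A"
  have B_in: "B y \<in> X" and AB: "A (B y) = y" if "y \<in> X" for y
    using inv_into_into[OF surj[OF that]] f_inv_into_f[OF surj[OF that]] by (auto simp: B_def)
  have "bounded_op_on X B"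
    unfolding bounded_op_on_def
  proof (intro conjI ballI allI exI)
    fix x y c assume x: "x \<in> X" and y: "y \<in> X"
    show "B (x + y) = B x + B y" by (rule inj) (use x y in \<open>simp_all add: XD B_in AB A_add\<close>)
    show "B (c *\<^sub>C x) = c *\<^sub>C B x" by (rule inj) (use x in \<open>simp_all add: XD B_in AB A_sc\<close>)
    show "B x \<in> X" using x by (rule B_in)
    show "norm (B x) \<le> (1 / m) * norm x" using below[OF B_in[OF x]] AB[OF x] m
      by (simp add: field_simps)
  qed
  moreover have "B (A x) = x" if "x \<in> X" for x by (rule inj) (use that in \<open>simp_all add: B_in A_in AB\<close>)
  ultimately show ?thesis using A AB unfolding invertible_op_on_def by blast
qed


section \<open>Square roots of coercive operators\<close>

text \<open>After scaling, \<open>Q = 1 - Z\<close> with \<open>\<parallel>Z\<parallel> < 1\<close>, and \<open>1 - B\<close> is a square root of \<open>1 - Z\<close> exactly if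
  \<open>B = (Z + B\<^sup>2) / 2\<close>. The right-hand side is a contraction on every ball whose radius lies
  between \<open>\<parallel>Z\<parallel>\<close> and \<open>1\<close>, and the symmetric operators that leave a given closed subspace invariant form a closed set which it
  preserves.\<close>

lemma symmetric_coercive_square_root:
  fixes Q :: "'a::complex_hilbert \<Rightarrow> 'a"
  assumes Q: "bounded_op Q" and sym: "\<And>x y. cinner (Q x) y = cinner x (Q y)"
    and m: "0 < m" and coercive: "\<And>x. m * (norm x)\<^sup>2 \<le> Re (cinner (Q x) x)"
    and K: "closed_csubspace K" and QK: "\<And>x. x \<in> K \<Longrightarrow> Q x \<in> K"
  obtains L where "bounded_op L" "\<And>x y. cinner (L x) y = cinner x (L y)"
    "\<And>x. x \<in> K \<Longrightarrow> L x \<in> K" "\<And>x. L (L x) = Q x"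
proof -
  note KD = closed_csubspaceD[OF K]
  obtain M0 where M0: "\<And>x. norm (Q x) \<le> M0 * norm x" using bounded_op_on_bound[OF Q] by auto
  define M where "M = max M0 m"
  have M: "norm (Q x) \<le> M * norm x" for x
    using M0[of x] mult_right_mono[of M0 M "norm x"] by (simp add: M_def)
  have "0 < M" "m \<le> M" using m by (auto simp: M_def)
  \<comment> \<open>\<open>t\<close> minimises the bound \<open>1 + t\<^sup>2 M\<^sup>2 - 2 t m\<close> for \<open>\<parallel>1 - t Q\<parallel>\<^sup>2\<close>, and the minimum is \<open>q\<^sup>2\<close>.\<close>
  define t where "t = m / M\<^sup>2"
  define q where "q = sqrt (1 - (m / M)\<^sup>2)"
  have t: "0 < t" using m \<open>0 < M\<close> by (simp add: t_def)
  have "0 < m / M" "m / M \<le> 1" using m \<open>0 < M\<close> \<open>m \<le> M\<close> by auto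
  then have q: "0 \<le> q" "q < 1" "q\<^sup>2 = 1 - (m / M)\<^sup>2"
    by (auto simp: q_def power_le_one)
  define z where "z x = x - t *\<^sub>R Q x" for x
  have z: "bounded_op z" unfolding z_def
    by (intro bounded_op_diff bounded_op_id bounded_op_scaleR Q)
  have z_le: "norm (z x) \<le> q * norm x" for x
  proof -
    have "(norm (z x))\<^sup>2 = (norm x)\<^sup>2 + t\<^sup>2 * (norm (Q x))\<^sup>2 - 2 * t * Re (cinner (Q x) x)"
      by (simp add: z_def norm_diff_squared power_mult_distrib cinner.scaleR_right flip: sym)
    also have "\<dots> \<le> (norm x)\<^sup>2 + t\<^sup>2 * (M * norm x)\<^sup>2 - 2 * t * (m * (norm x)\<^sup>2)"
      using t by (intro add_mono diff_mono mult_left_mono power_mono M coercive) auto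
    also have "\<dots> = (q * norm x)\<^sup>2"
      using \<open>0 < M\<close> unfolding power_mult_distrib q(3)
      by (simp add: t_def power2_eq_square field_simps)
    finally show ?thesis by (rule power2_le_imp_le) (use q(1) in simp)
  qed
  define Z where "Z = Blinfun z"
  have Z: "blinfun_apply Z x = x - t *\<^sub>R Q x" for x
    using bounded_linear_Blinfun_apply[OF bounded_op_linear[OF z]] by (simp add: Z_def z_def)
  have nZ: "norm Z \<le> q"
    by (rule norm_blinfun_bound[OF q(1)]) (use z_le in \<open>simp add: Z z_def\<close>)
  define D where "D = {B :: 'a \<Rightarrow>\<^sub>L 'a. norm B \<le> q \<and>
      (\<forall>x y. cinner (blinfun_apply B x) y = cinner x (blinfun_apply B y)) \<and>
      (\<forall>x\<in>K. blinfun_apply B x \<in> K)}"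
  define F where "F B = (1/2) *\<^sub>R (Z + (B o\<^sub>L B))" for B
  have FD: "F B \<in> D" if "B \<in> D" for B
  proof -
    have "norm (B o\<^sub>L B) \<le> q * q"
      using that norm_blinfun_compose[of B B] mult_mono[of "norm B" q "norm B" q] q
      by (auto simp: D_def intro: order_trans)
    also have "q * q \<le> q" using q by (simp add: mult_left_le)
    finally have "norm (F B) \<le> q" using nZ norm_triangle_ineq[of Z "B o\<^sub>L B"] by (simp add: F_def)
    moreover have "blinfun_apply (F B) x = (1/2) *\<^sub>R ((x - t *\<^sub>R Q x) + B (B x))" for x
      by (simp add: F_def Z blinfun.bilinear_simps)
    ultimately show ?thesis
      using that by (auto simp: D_def KD QK sym cinner.add_left cinner.add_right cinner.diff_left
          cinner.diff_right cinner.scaleR_left cinner.scaleR_right)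
  qed
  have "closed D"
  proof -
    have "D = {B. norm B \<le> q} \<inter>
        {B. \<forall>x y. cinner (blinfun_apply B x) y = cinner x (blinfun_apply B y)} \<inter>
        (\<Inter>x\<in>K. (\<lambda>B. blinfun_apply B x) -` K)"
      by (auto simp: D_def)
    moreover have "closed ((\<lambda>B. blinfun_apply B x) -` K)" for x
      by (intro closed_vimage KD(6) continuous_intros)
    moreover have "closed {B. norm (B :: 'a \<Rightarrow>\<^sub>L 'a) \<le> q}"
      by (intro closed_Collect_le continuous_intros)
    moreover have "closed {B. \<forall>x y. cinner (blinfun_apply B x) y = cinner x (blinfun_apply B y)}"
      by (intro closed_Collect_all closed_Collect_eq cinner.continuous_on continuous_intros)
    ultimately show ?thesis by (simp only:) (intro closed_Int closed_INT ballI)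
  qed
  have "\<exists>!B. B \<in> D \<and> F B = B"
  proof (rule Banach_fix)
    show "complete D" using \<open>closed D\<close> by (simp add: complete_eq_closed)
    have "0 \<in> D" using q(1) KD(1) by (simp add: D_def)
    then show "D \<noteq> {}" by blast
    show "F ` D \<subseteq> D" using FD by blast
    fix B C assume "B \<in> D" "C \<in> D"
    then have le: "norm B \<le> q" "norm C \<le> q" by (auto simp: D_def)
    have "F B - F C = (1/2) *\<^sub>R ((B o\<^sub>L (B - C)) + ((B - C) o\<^sub>L C))"
      by (rule blinfun_eqI) (simp add: F_def blinfun.bilinear_simps algebra_simps)
    moreover have "norm (B o\<^sub>L (B - C)) \<le> q * norm (B - C)"
      using norm_blinfun_compose mult_right_mono[OF le(1) norm_ge_zero] by (rule order_trans)
    moreover have "norm ((B - C) o\<^sub>L C) \<le> q * norm (B - C)"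
      using norm_blinfun_compose[of "B - C" C] mult_left_mono[OF le(2) norm_ge_zero, of "B - C"]
      by (simp add: mult.commute)
    ultimately show "dist (F B) (F C) \<le> q * dist B C"
      using norm_triangle_ineq[of "B o\<^sub>L (B - C)" "(B - C) o\<^sub>L C"] by (simp add: dist_norm)
  qed (use q in auto)
  then obtain B where B: "B \<in> D" and FB: "F B = B" by blast
  have BB: "2 *\<^sub>R B x = (x - t *\<^sub>R Q x) + B (B x)" for x
  proof -
    have "2 *\<^sub>R B x = 2 *\<^sub>R F B x" by (simp add: FB)
    then show ?thesis by (simp add: F_def Z blinfun.bilinear_simps)
  qed
  have Bsym: "cinner (B x) y = cinner x (B y)" for x y using B by (simp add: D_def)
  define s where "s = 1 / sqrt t"
  have s: "s * s * t = 1" using t by (simp add: s_def)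
  define L where "L x = s *\<^sub>R (x - B x)" for x
  have "B (c *\<^sub>C x) = c *\<^sub>C B x" for c x
    by (rule cinner_ext) (simp add: Bsym cinner_scaleC_left)
  then have "bounded_op (blinfun_apply B)"
    by (simp add: bounded_op_iff_bounded_linear blinfun.bounded_linear_right)
  then have "bounded_op L"
    unfolding L_def by (intro bounded_op_scaleR bounded_op_diff bounded_op_id)
  moreover have "cinner (L x) y = cinner x (L y)" for x y
    by (simp add: L_def Bsym cinner.diff_left cinner.diff_right cinner.scaleR_left cinner.scaleR_right)
  moreover have "L x \<in> K" if "x \<in> K" for x using that B by (simp add: L_def D_def KD)
  moreover have "L (L x) = Q x" for x
  proof -
    have "L (L x) = (s * s) *\<^sub>R (x - 2 *\<^sub>R B x + B (B x))"
      by (simp add: L_def blinfun.bilinear_simps scaleR_2 algebra_simps)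
    also have "\<dots> = (s * s * t) *\<^sub>R Q x" by (simp add: BB)
    finally show ?thesis by (simp add: s)
  qed
  ultimately show ?thesis using that by blast
qed


section \<open>Quasi-isometries that are bounded below\<close>

text \<open>If \<open>L\<close> satisfies \<open>\<parallel>L x\<parallel> = \<parallel>S x\<parallel>\<close> for all \<open>x\<close>, then \<open>\<parallel>L (S x)\<parallel> = \<parallel>S (S x)\<parallel> = \<parallel>S x\<parallel> = \<parallel>L x\<parallel>\<close>, so \<open>S\<close> is an
  isometry up to conjugation with \<open>L\<close>. The operator \<open>L = (S\<^sup>*S)\<^bsup>1/2\<^esup>\<close> has this property and is
  invertible because \<open>S\<close> is bounded below. To stay with total operators, \<open>S\<^sup>*S\<close> is extended by the
  identity on the orthogonal complement of \<open>K\<close>.\<close>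

lemma bounded_below_similar_to_isometry:
  fixes K :: "'a::complex_hilbert set"
  assumes K: "closed_csubspace K" and S: "bounded_op_on K S"
    and iso: "\<And>x. x \<in> K \<Longrightarrow> norm (S (S x)) = norm (S x)"
    and m: "0 < m" and below: "\<And>x. x \<in> K \<Longrightarrow> m * norm x \<le> norm (S x)"
  shows "similar_to_isometry_on K S"
proof -
  note KD = closed_csubspaceD[OF K]
  define P where "P = orth_proj K"
  define S' where "S' x = S (P x)" for x
  define Q where "Q x = adj S' (S' x) + (x - P x)" for x
  have P: "bounded_op P" unfolding P_def by (rule bounded_op_orth_proj[OF K])
  have P_in: "P x \<in> K" for x by (simp add: P_def orth_proj_in K)
  have P_id: "P x = x" if "x \<in> K" for x using that by (simp add: P_def orth_proj_fixes K)
  have S': "bounded_op S'"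
    unfolding S'_def P_def by (rule bounded_op_compose_orth_proj[OF K S])
  have Q: "bounded_op Q" unfolding Q_def
    by (intro bounded_op_add bounded_op_diff bounded_op_id P
        bounded_op_on_compose[OF bounded_op_adj[OF S'] S'])
  have form: "cinner (Q x) y = cinner (S' x) (S' y) + cinner (x - P x) (y - P y)" for x y
    using cinner_orth_proj[OF K, of x y]
    by (simp add: Q_def cinner.add_left cinner_adj_left[OF S'] cinner.diff_left cinner.diff_right P_def)
  have form': "cinner x (Q y) = cinner (S' x) (S' y) + cinner (x - P x) (y - P y)" for x y
    using form[of y x] cinner_commute[of x "Q y"]
    by (simp add: cinner_commute[of "S' x"] cinner_commute[of "x - P x"])
  have coercive: "min 1 (m\<^sup>2) * (norm x)\<^sup>2 \<le> Re (cinner (Q x) x)" for x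
  proof -
    have "(m * norm (P x))\<^sup>2 \<le> (norm (S' x))\<^sup>2"
      using below[OF P_in] m by (intro power_mono) (auto simp: S'_def)
    moreover have "min 1 (m\<^sup>2) * (norm (P x))\<^sup>2 \<le> m\<^sup>2 * (norm (P x))\<^sup>2"
      "min 1 (m\<^sup>2) * (norm (x - P x))\<^sup>2 \<le> 1 * (norm (x - P x))\<^sup>2"
      by (intro mult_right_mono; simp)+
    ultimately show ?thesis
      using norm_orth_proj_decomp[OF K, of x]
      by (simp add: form Re_cinner_self P_def power_mult_distrib distrib_left)
  qed
  have QK: "Q x \<in> K" if x: "x \<in> K" for x
  proof -
    define v where "v = Q x - P (Q x)"
    have "P v = 0" unfolding v_def P_def
      by (intro orth_proj_eqI K KD) (simp add: orth_proj_orth K)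
    then have "S' v = S' 0" by (simp add: S'_def P_id KD(1))
    then have "S' v = 0" using linear_0[OF bounded_linear.linear[OF bounded_op_linear[OF S']]] by simp
    then have "cinner (Q x) v = 0" using x by (simp add: form P_id)
    moreover have "cinner v (P (Q x)) = 0" using orth_proj_orth[OF K P_in]
      by (simp add: v_def P_def)
    ultimately have "cinner v v = 0"
      by (simp add: v_def cinner.diff_left cinner_eq_0_commute[of "P (Q x)"])
    then show ?thesis using P_in[of "Q x"] by (simp add: v_def)
  qed
  have sym: "cinner (Q x) y = cinner x (Q y)" for x y by (simp only: form form')
  have "0 < min 1 (m\<^sup>2)" using m by simp
  then obtain L where L: "bounded_op L" "\<And>x y. cinner (L x) y = cinner x (L y)"
    "\<And>x. x \<in> K \<Longrightarrow> L x \<in> K" "\<And>x. L (L x) = Q x"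
    using symmetric_coercive_square_root[OF Q sym _ coercive K QK] by blast
  have norm_L: "norm (L x) = norm (S x)" if "x \<in> K" for x
  proof -
    have "(norm (L x))\<^sup>2 = (norm (S x))\<^sup>2"
      unfolding Re_cinner_self[symmetric] L(2) L(4)
      using that by (simp add: form' P_id) (simp add: S'_def P_id)
    then show ?thesis by (simp add: power2_eq_iff_nonneg)
  qed
  have LK: "bounded_op_on K L" by (rule bounded_op_on_subset[OF L(1,3)])
  have invL: "invertible_op_on K L"
    by (rule invertible_op_on_symmetric[OF K LK L(2) m]) (simp add: norm_L below)
  then obtain B where B: "bounded_op_on K B" and LB: "\<And>x. x \<in> K \<Longrightarrow> L (B x) = x" "\<And>x. x \<in> K \<Longrightarrow> B (L x) = x"
    by (auto simp: invertible_op_on_def)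
  have in_K: "S x \<in> K" "B x \<in> K" if "x \<in> K" for x using that S B by (auto simp: bounded_op_on_def)
  have "isometric_on K (\<lambda>x. L (S (B x)))"
    unfolding isometric_on_def
  proof (intro conjI ballI)
    show "bounded_op_on K (\<lambda>x. L (S (B x)))"
      by (intro bounded_op_on_compose[OF LK] bounded_op_on_compose[OF S] B)
    show "norm (L (S (B x))) = norm x" if "x \<in> K" for x
      using norm_L[of "B x"] that by (simp add: norm_L in_K iso LB)
  qed
  moreover have "L (S x) = L (S (B (L x)))" if "x \<in> K" for x using that by (simp add: LB)
  ultimately show ?thesis using invL unfolding similar_to_isometry_on_def by blast
qed


section \<open>Prepending an entry to a square-summable sequence\<close>

lift_definition ell2_Cons :: "'a::complex_hilbert \<Rightarrow> 'a ell2 \<Rightarrow> 'a ell2" is "\<lambda>x f n. case n of 0 \<Rightarrow> x | Suc m \<Rightarrow> f m"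
  by (subst summable_Suc_iff[symmetric]) simp

lift_definition ell2_tl :: "'a::complex_hilbert ell2 \<Rightarrow> 'a ell2" is "\<lambda>f n. f (Suc n)"
  by (subst summable_Suc_iff)

abbreviation ell2_hd :: "'a::complex_hilbert ell2 \<Rightarrow> 'a" where
  "ell2_hd f \<equiv> ell2_nth f 0"

lemma ell2_hd_Cons [simp]: "ell2_hd (ell2_Cons x f) = x"
  by transfer simp

lemma ell2_tl_Cons [simp]: "ell2_tl (ell2_Cons x f) = f"
  by transfer simp

lemma ell2_Cons_add: "ell2_Cons (x + y) (f + g) = ell2_Cons x f + ell2_Cons y g"
  by transfer (auto simp: fun_eq_iff split: nat.split)

lemma ell2_Cons_scaleC: "ell2_Cons (c *\<^sub>C x) (c *\<^sub>C f) = c *\<^sub>C ell2_Cons x f"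
  by transfer (auto simp: fun_eq_iff split: nat.split)

lemma ell2_nth_add: "ell2_nth (f + g) n = ell2_nth f n + ell2_nth g n"
  by transfer simp

lemma ell2_nth_scaleC: "ell2_nth (c *\<^sub>C f) n = c *\<^sub>C ell2_nth f n"
  by transfer simp

lemma ell2_tl_add: "ell2_tl (f + g) = ell2_tl f + ell2_tl g"
  by transfer simp

lemma ell2_tl_scaleC: "ell2_tl (c *\<^sub>C f) = c *\<^sub>C ell2_tl f"
  by transfer simp

lemma cinner_ell2_split: "cinner f g = cinner (ell2_hd f) (ell2_hd g) + cinner (ell2_tl f) (ell2_tl g)"
  by transfer (simp add: suminf_split_head[OF ell2_cinner_summable])

lemma norm_ell2_split: "(norm f)\<^sup>2 = (norm (ell2_hd f))\<^sup>2 + (norm (ell2_tl f))\<^sup>2"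
  using arg_cong[OF cinner_ell2_split[of f f], of Re] by (simp add: Re_cinner_self)

lemma norm_ell2_tl_le: "norm (ell2_tl f) \<le> norm f"
  using norm_ell2_split[of f] by (simp add: power2_le_imp_le)

lemma bounded_linear_ell2_nth: "bounded_linear (\<lambda>f :: 'a::complex_hilbert ell2. ell2_nth f n)"
proof (rule bounded_linear_intro[where K=1])
  show "ell2_nth (r *\<^sub>R f) n = r *\<^sub>R ell2_nth f n" for r and f :: "'a ell2" by transfer simp
qed (simp_all add: ell2_nth_add norm_ell2_nth_le)

lemma ell2_hd_tl: "ell2_hd (ell2_tl f) = ell2_nth f 1"
  by transfer simp


section \<open>The operator A\<close>

text \<open>This direction of \<open>\<N>(T\<^sup>*)\<^sup>\<bottom> = closure (\<R>(T))\<close> lets continuity extend identities and inequalities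
  from the range of \<open>T\<close> to the vectors \<open>x - N x\<close> below.\<close>

lemma orthogonal_adj_kernel_in_closure_range:
  assumes T: "bounded_op T" and x: "\<And>n. adj T n = 0 \<Longrightarrow> cinner x n = 0"
  shows "x \<in> closure (range T)"
proof -
  note T_lin = bounded_op_linear[OF T]
  have "0 \<in> range T" using linear_0[OF bounded_linear.linear[OF T_lin]] by (metis rangeI)
  then have "0 \<in> closure (range T)" by (rule subsetD[OF closure_subset])
  moreover have "u + v \<in> closure (range T)" if u: "u \<in> closure (range T)" and v: "v \<in> closure (range T)" for u v
  proof -
    obtain a where a: "\<And>n. a n \<in> range T" "a \<longlonglongrightarrow> u"
      using u unfolding closure_sequential by metis
    obtain b where b: "\<And>n. b n \<in> range T" "b \<longlonglongrightarrow> v"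
      using v unfolding closure_sequential by metis
    have "a n + b n \<in> range T" for n
    proof -
      obtain s t where "a n = T s" "b n = T t" using a(1)[of n] b(1)[of n] by blast
      then have "a n + b n = T (s + t)" using T by (simp add: bounded_op_on_def)
      then show ?thesis by simp
    qed
    moreover have "(\<lambda>n. a n + b n) \<longlonglongrightarrow> u + v" by (rule tendsto_add[OF a(2) b(2)])
    ultimately show ?thesis
      unfolding closure_sequential by (intro exI[of _ "\<lambda>n. a n + b n"] conjI allI)
  qed
  moreover have "c *\<^sub>C u \<in> closure (range T)" if "u \<in> closure (range T)" for c u
  proof -
    have "(\<lambda>x. c *\<^sub>C x) ` range T \<subseteq> range T"
    proof (clarify)
      fix z
      have "c *\<^sub>C T z = T (c *\<^sub>C z)" using T by (simp add: bounded_op_on_def)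
      then show "c *\<^sub>C T z \<in> range T" by simp
    qed
    then have "closure ((\<lambda>x. c *\<^sub>C x) ` range T) \<subseteq> closure (range T)" by (rule closure_mono)
    moreover have "c *\<^sub>C u \<in> closure ((\<lambda>x. c *\<^sub>C x) ` range T)"
      using closure_bounded_linear_image_subset[OF bounded_linear_scaleC[of c], of "range T"] that
      by (rule subsetD[OF _ imageI])
    ultimately show ?thesis by (rule subsetD)
  qed
  ultimately have C: "closed_csubspace (closure (range T))" by (simp add: closed_csubspace_def)
  define p where "p = orth_proj (closure (range T)) x"
  have p: "p \<in> closure (range T)" by (simp add: p_def orth_proj_in C)
  have orth: "cinner (x - p) y = 0" if "y \<in> closure (range T)" for y
    using that by (simp add: p_def orth_proj_orth C)
  have "T z \<in> closure (range T)" for z by (rule subsetD[OF closure_subset rangeI])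
  then have "adj T (x - p) = 0"
    by (intro cinner_ext) (simp add: cinner_adj_left[OF T] orth)
  then have "cinner x (x - p) = 0" by (rule x)
  moreover have "cinner p (x - p) = 0" using orth[OF p] cinner_eq_0_commute by blast
  ultimately have "cinner (x - p) (x - p) = 0" by (simp add: cinner.diff_left)
  then show ?thesis using p by simp
qed

text \<open>These are the three hypotheses on \<open>T\<close> of the theorem: \<open>expansive\<close> and \<open>isometric\<close> compare the quadratic
  forms of \<open>T\<^sup>*T\<close>, \<open>T\<^sup>*\<^sup>2T\<^sup>2\<close> and \<open>T\<^sup>*\<^sup>3T\<^sup>3\<close>, and \<open>reducing\<close> is the invariance of the kernel of \<open>T\<^sup>*\<close>.\<close>

locale quasi_expansive =
  fixes T :: "'a::complex_hilbert \<Rightarrow> 'a"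
  assumes T: "bounded_op T"
    and expansive: "norm (T x) \<le> norm (T (T x))"
    and isometric: "norm (T (T (T x))) = norm (T (T x))"
    and reducing: "adj T n = 0 \<Longrightarrow> adj T (adj T (T n)) = 0"
begin

lemma T_diff: "T (x - y) = T x - T y"
  using linear_diff[OF bounded_linear.linear[OF bounded_op_linear[OF T]]] .

lemma T_zero [simp]: "T 0 = 0"
  using T_diff[of 0 0] by simp

lemma adj_T_zero [simp]: "adj T 0 = 0"
  by (rule cinner_ext) (simp add: cinner_adj_left[OF T])

lemma expansive_on_closure:
  assumes "x \<in> closure (range T)"
  shows "norm x \<le> norm (T x)"
proof -
  have "closed {x. norm x \<le> norm (T x)}"
    by (intro closed_Collect_le continuous_intros linear_continuous_on bounded_op_linear T)
  moreover have "range T \<subseteq> {x. norm x \<le> norm (T x)}" using expansive by auto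
  ultimately have "closure (range T) \<subseteq> {x. norm x \<le> norm (T x)}" by (intro closure_minimal)
  then show ?thesis using assms by auto
qed

text \<open>Put \<open>y = T\<^sup>2 u\<close> and \<open>d = T\<^sup>*T y - y\<close>. Both vectors lie in the closure of the range of \<open>T\<close>, where \<open>T\<close>
  is expansive. The function \<open>s \<mapsto> \<parallel>T (y - s d)\<parallel>\<^sup>2 - \<parallel>y - s d\<parallel>\<^sup>2\<close> is thus nonnegative; it vanishes at \<open>0\<close>
  and has derivative \<open>-2 \<parallel>d\<parallel>\<^sup>2\<close> there, which forces \<open>d = 0\<close>.\<close>

lemma adj_T_T_range_T_squared: "adj T (T (T (T u))) = T (T u)"
proof -
  define y where "y = T (T u)"
  define d where "d = adj T (T y) - y"
  obtain M where M: "0 < M" "\<And>x. norm (T x) \<le> M * norm x"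
    using bounded_op_on_bound[OF T] by auto
  have y: "cinner y n = 0" if "adj T n = 0" for n
    using that by (simp add: y_def cinner_adj[OF T, symmetric])
  have "cinner (adj T (T y)) n = 0" if "adj T n = 0" for n
  proof -
    have "cinner (adj T (T y)) n = cinner y (adj T (T n))"
      by (simp add: cinner_adj[OF T] cinner_adj_left[OF T])
    then show ?thesis using y reducing that by simp
  qed
  with y have d: "cinner d n = 0" if "adj T n = 0" for n using that by (simp add: d_def cinner.diff_left)
  \<comment> \<open>so small that the linear term \<open>2 s \<parallel>d\<parallel>\<^sup>2\<close> beats the quadratic one, \<open>s\<^sup>2 \<parallel>T d\<parallel>\<^sup>2 \<le> s \<parallel>d\<parallel>\<^sup>2\<close>\<close>
  define s where "s = 1 / M\<^sup>2"
  have s: "0 < s" "s * M\<^sup>2 = 1" using M by (auto simp: s_def)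
  have scT: "T (r *\<^sub>R x) = r *\<^sub>R T x" for r x
    using linear_scale[OF bounded_linear.linear[OF bounded_op_linear[OF T]]] .
  have "norm (y - s *\<^sub>R d) \<le> norm (T (y - s *\<^sub>R d))"
    by (intro expansive_on_closure orthogonal_adj_kernel_in_closure_range T)
       (simp add: cinner.diff_left cinner.scaleR_left y d)
  then have "(norm (y - s *\<^sub>R d))\<^sup>2 \<le> (norm (T y - s *\<^sub>R T d))\<^sup>2"
    by (simp add: power_mono T_diff scT)
  then have "s\<^sup>2 * (norm d)\<^sup>2 + 2 * s * Re (cinner (T y) (T d) - cinner y d) \<le> s\<^sup>2 * (norm (T d))\<^sup>2"
    using isometric[of u]
    by (simp add: norm_diff_squared power_mult_distrib cinner.scaleR_right y_def algebra_simps)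
  also have "cinner (T y) (T d) - cinner y d = cinner d d"
    by (simp add: d_def cinner.diff_left cinner_adj_left[OF T])
  also have "s\<^sup>2 * (norm (T d))\<^sup>2 \<le> s\<^sup>2 * (M * norm d)\<^sup>2"
    by (intro mult_left_mono power_mono M) auto
  also have "\<dots> = s * (norm d)\<^sup>2"
    using s(2) by (simp add: power_mult_distrib power2_eq_square[of s])
  finally have "s * (norm d)\<^sup>2 + s\<^sup>2 * (norm d)\<^sup>2 \<le> 0" by (simp add: Re_cinner_self)
  then have "(s + s\<^sup>2) * (norm d)\<^sup>2 \<le> 0" by (simp add: distrib_right)
  moreover have "0 < s + s\<^sup>2" using s(1) by (simp add: add_pos_nonneg)
  ultimately have "d = 0" by (simp add: mult_le_0_iff)
  then show ?thesis by (simp add: d_def y_def)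
qed

lemma adj_T_T_T_closure:
  assumes "x \<in> closure (range T)"
  shows "adj T (T (T x)) = T x"
proof -
  have "bounded_op (\<lambda>x. adj T (T (T x)))"
    by (intro bounded_op_on_compose[OF bounded_op_adj] bounded_op_on_compose[OF T] T)
  then have "closed {x. adj T (T (T x)) = T x}"
    by (intro closed_Collect_eq linear_continuous_on bounded_op_linear T)
  moreover have "range T \<subseteq> {x. adj T (T (T x)) = T x}" using adj_T_T_range_T_squared by auto
  ultimately have "closure (range T) \<subseteq> {x. adj T (T (T x)) = T x}" by (intro closure_minimal)
  then show ?thesis using assms by auto
qed

definition N :: "'a \<Rightarrow> 'a" where "N = orth_proj {x. adj T x = 0}"

definition P :: "'a \<Rightarrow> 'a" where "P = orth_proj {x. adj T (adj T x) = 0}"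

definition R :: "'a \<Rightarrow> 'a" where "R x = T (T (N x))"

text \<open>In \<open>\<langle>A x, x\<rangle> = \<parallel>T x\<parallel>\<^sup>2 + \<parallel>P x\<parallel>\<^sup>2 + \<parallel>R x\<parallel>\<^sup>2\<close>, the first two terms dominate \<open>\<parallel>x\<parallel>\<^sup>2\<close>, and \<open>P\<close> is what
  is left of \<open>A\<close> when \<open>T\<^sup>*A T\<close> is subtracted. The term \<open>R\<^sup>*R\<close> compensates for the part of \<open>T\<^sup>*\<^sup>2T\<^sup>2\<close> that comes
  from the kernel of \<open>T\<^sup>*\<close>, on which \<open>T\<^sup>*T\<close> and \<open>T\<^sup>*\<^sup>2T\<^sup>2\<close> may differ.\<close>

definition A :: "'a \<Rightarrow> 'a" where "A x = adj T (T x) + P x + adj R (R x)"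

lemma kernel_N: "closed_csubspace {x. adj T x = 0}"
  using bounded_op_adj[OF T] by (intro closed_csubspace_eq_zero) (auto simp: bounded_op_iff_bounded_linear)

lemma kernel_P: "closed_csubspace {x. adj T (adj T x) = 0}"
  using bounded_op_on_compose[OF bounded_op_adj[OF T] bounded_op_adj[OF T]]
  by (intro closed_csubspace_eq_zero) (auto simp: bounded_op_iff_bounded_linear)

lemma bounded_N: "bounded_op N" unfolding N_def by (rule bounded_op_orth_proj[OF kernel_N])

lemma bounded_P: "bounded_op P" unfolding P_def by (rule bounded_op_orth_proj[OF kernel_P])

lemma bounded_R: "bounded_op R"
  unfolding R_def by (intro bounded_op_on_compose[OF T] bounded_N)

lemma bounded_A: "bounded_op A"
  unfolding A_def
  by (intro bounded_op_add bounded_P bounded_op_on_compose[OF bounded_op_adj] T bounded_R)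

lemma adj_T_N: "adj T (N x) = 0"
  using orth_proj_in[OF kernel_N] by (simp add: N_def)

lemma N_orth: "adj T n = 0 \<Longrightarrow> cinner (x - N x) n = 0"
  using orth_proj_orth[OF kernel_N] by (simp add: N_def)

lemma diff_N_in_closure: "x - N x \<in> closure (range T)"
  by (rule orthogonal_adj_kernel_in_closure_range[OF T N_orth])

lemma N_T: "N (T x) = 0"
  unfolding N_def
  by (rule orth_proj_eqI[OF kernel_N]) (auto simp flip: cinner_adj[OF T])

text \<open>The invariance of the kernel of \<open>T\<^sup>*\<close> under \<open>T\<^sup>*T\<close> says that \<open>T\<close> maps it into the kernel of \<open>T\<^sup>*\<^sup>2\<close>;
  the orthogonal complement of the former is mapped into that of the latter.\<close>

lemma P_T: "P (T x) = T (N x)"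
  unfolding P_def
proof (rule orth_proj_eqI[OF kernel_P])
  show "T (N x) \<in> {x. adj T (adj T x) = 0}" using reducing adj_T_N by simp
  fix y assume "y \<in> {x. adj T (adj T x) = 0}"
  then have "cinner (x - N x) (adj T y) = 0" by (intro N_orth) simp
  then show "cinner (T x - T (N x)) y = 0" by (simp add: cinner_adj[OF T] T_diff)
qed

lemma N_P: "N (P x) = N x"
  unfolding N_def
proof (rule orth_proj_eqI[OF kernel_N])
  show "orth_proj {x. adj T x = 0} x \<in> {x. adj T x = 0}" by (rule orth_proj_in[OF kernel_N])
  fix n assume "n \<in> {x. adj T x = 0}"
  then have "cinner (x - P x) n = 0" "cinner (x - N x) n = 0"
    using orth_proj_orth[OF kernel_P] N_orth by (auto simp: P_def)
  then show "cinner (P x - orth_proj {x. adj T x = 0} x) n = 0"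
    by (simp add: cinner.diff_left flip: N_def)
qed

lemma R_P: "R (P x) = R x"
  by (simp add: R_def N_P)

text \<open>The cross terms vanish because \<open>T\<^sup>*T\<close> leaves the kernel of \<open>T\<^sup>*\<close> invariant.\<close>

lemma cinner_T_T: "cinner (T x) (T y) = cinner (T (x - N x)) (T (y - N y)) + cinner (T (N x)) (T (N y))"
proof -
  have "cinner (T (x - N x)) (T (N y)) = 0" for x y
    by (simp add: N_orth reducing adj_T_N flip: cinner_adj[OF T])
  moreover from this have "cinner (T (N x)) (T (y - N y)) = 0" for x y
    using cinner_eq_0_commute by blast
  ultimately have "cinner (T (x - N x) + T (N x)) (T (y - N y) + T (N y))
      = cinner (T (x - N x)) (T (y - N y)) + cinner (T (N x)) (T (N y))"
    by (simp add: cinner.add_left cinner.add_right)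
  then show ?thesis by (simp add: T_diff)
qed

lemma cinner_P: "cinner (P x) y = cinner (P x) (P y)" "cinner x (P y) = cinner (P x) (P y)"
  unfolding P_def by (rule cinner_orth_proj[OF kernel_P])+

lemma cinner_A: "cinner (A x) y = cinner (T x) (T y) + cinner (P x) (P y) + cinner (R x) (R y)"
  by (simp add: A_def cinner.add_left cinner_adj_left T bounded_R cinner_P(1)[of x y])

lemma A_symmetric: "cinner (A x) y = cinner x (A y)"
  using cinner_A[of y x] cinner_commute[of x "A y"]
  by (simp add: cinner_A cinner_commute[of "T x"] cinner_commute[of "P x"] cinner_commute[of "R x"])

text \<open>The part \<open>x - N x\<close> is dominated by \<open>T x\<close>, where \<open>T\<close> is expansive, and the part \<open>N x\<close> by \<open>P x\<close>.\<close>

lemma A_coercive: "(norm x)\<^sup>2 \<le> Re (cinner (A x) x)"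
proof -
  have "(norm (x - N x))\<^sup>2 \<le> (norm (T (x - N x)))\<^sup>2"
    using expansive_on_closure[OF diff_N_in_closure] by (intro power_mono) auto
  also have "\<dots> \<le> (norm (T x))\<^sup>2"
    using arg_cong[OF cinner_T_T[of x x], of Re] by (simp add: Re_cinner_self)
  finally have "(norm (x - N x))\<^sup>2 \<le> (norm (T x))\<^sup>2" .
  moreover have "(norm (N x))\<^sup>2 \<le> (norm (P x))\<^sup>2"
    using norm_orth_proj_le[OF kernel_N, of "P x"] N_P by (intro power_mono) (auto simp: N_def)
  ultimately show ?thesis
    using norm_orth_proj_decomp[OF kernel_N, of x, folded N_def] zero_le_power2[of "norm (R x)"]
    unfolding cinner_A plus_complex.sel Re_cinner_self by linarith
qed

text \<open>With \<open>m = 1 - N\<close>, the identity \<open>T\<^sup>*T (T (m x)) = T (m x)\<close> turns every term of \<open>\<langle>T\<^sup>2 x, T\<^sup>2 y\<rangle>\<close> into a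
  term of \<open>\<langle>T x, T y\<rangle>\<close>, except that \<open>\<langle>R x, R y\<rangle>\<close> takes the place of \<open>\<langle>T (N x), T (N y)\<rangle>\<close>. The latter is
  restored by \<open>P\<close>, since \<open>P T = T N\<close>.\<close>

lemma cinner_A_T: "cinner (A (T x)) (T y) + cinner (P x) (P y) = cinner (A x) y"
proof -
  define m where "m x = x - N x" for x
  have GT: "adj T (T (T (m x))) = T (m x)" for x
    unfolding m_def by (rule adj_T_T_T_closure[OF diff_N_in_closure])
  have Tm: "T x = T (m x) + T (N x)" for x by (simp add: m_def T_diff)
  have TTm: "T (T x) = T (T (m x)) + R x" for x by (simp add: m_def T_diff R_def)
  have "cinner (T (T (m x))) (T z) = cinner (T (m x)) z" "cinner (T z) (T (T (m x))) = cinner z (T (m x))" for x z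
    using GT cinner_adj_left[OF T, of "T (T (m x))" z] cinner_adj[OF T, of z "T (T (m x))"] by simp_all
  then have "cinner (T (T x)) (T (T y))
      = cinner (T (m x)) (T y) + cinner (T (N x)) (T (m y)) + cinner (R x) (R y)"
    unfolding TTm[of x] TTm[of y] by (simp add: cinner.add_left cinner.add_right R_def Tm[of y])
  moreover have "cinner (T x) (T y) = cinner (T (m x)) (T y) + cinner (T (N x)) (T (m y)) + cinner (T (N x)) (T (N y))"
    unfolding Tm[of x] Tm[of y] by (simp add: cinner.add_left cinner.add_right)
  ultimately show ?thesis
    by (simp add: cinner_A P_T R_def[of "T _"] N_T)
qed

lemma A_minus_adj_T_A_T: "A x - adj T (A (T x)) = P x"
proof (rule cinner_ext)
  fix z
  show "cinner (A x - adj T (A (T x))) z = cinner (P x) z"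
    unfolding cinner.diff_left cinner_adj_left[OF T] cinner_P(1)[of x z] diff_eq_eq
    using cinner_A_T[of x z] by (simp only: add.commute)
qed

lemma invertible_A: "invertible_op A"
proof (rule invertible_op_on_symmetric[OF closed_csubspace_UNIV bounded_A A_symmetric])
  show "1 * norm x \<le> norm (A x)" for x
  proof (cases "x = 0")
    case False
    have "norm x * norm x \<le> norm (A x) * norm x"
      using A_coercive[of x] cinner_Cauchy_Schwarz[of "A x" x] complex_Re_le_cmod[of "cinner (A x) x"]
      by (simp add: power2_eq_square)
    then show ?thesis using False by simp
  qed simp
qed simp

lemma range_P: "range P = {x. adj T (adj T x) = 0}"
proof
  show "range P \<subseteq> {x. adj T (adj T x) = 0}"
    unfolding P_def using orth_proj_in[OF kernel_P] by blast
  show "{x. adj T (adj T x) = 0} \<subseteq> range P"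
  proof
    fix x assume "x \<in> {x. adj T (adj T x) = 0}"
    then have "x = P x" unfolding P_def by (rule orth_proj_fixes[OF kernel_P, symmetric])
    then show "x \<in> range P" by (rule range_eqI)
  qed
qed

lemma P_adj_R: "P (adj R x) = adj R x"
proof (rule cinner_ext)
  fix z
  have "cinner (P (adj R x)) z = cinner (adj R x) (P z)"
    by (metis cinner_P)
  also have "\<dots> = cinner (adj R x) z" by (simp add: cinner_adj_left[OF bounded_R] R_P)
  finally show "cinner (P (adj R x)) z = cinner (adj R x) z" .
qed

text \<open>Since \<open>R P = R\<close>, the difference factors as \<open>P (1 + R\<^sup>*R)\<close>, and \<open>1 + R\<^sup>*R\<close> is surjective.\<close>

lemma range_A_minus_adj_T_T: "range (\<lambda>x. A x - adj T (T x)) = range P"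
proof -
  define C where "C x = x + adj R (R x)" for x
  have C: "bounded_op C" unfolding C_def
    by (intro bounded_op_add bounded_op_id bounded_op_on_compose[OF bounded_op_adj] bounded_R)
  have form: "cinner (C x) y = cinner x y + cinner (R x) (R y)"
    "cinner x (C y) = cinner x y + cinner (R x) (R y)" for x y
    by (simp_all add: C_def cinner.add_left cinner.add_right cinner_adj_left cinner_adj bounded_R)
  have "norm x \<le> norm (C x)" for x
  proof (rule power2_le_imp_le)
    have "Re (cinner x (adj R (R x))) \<ge> 0" by (simp add: cinner_adj[OF bounded_R] Re_cinner_self)
    then show "(norm x)\<^sup>2 \<le> (norm (C x))\<^sup>2" by (simp add: C_def norm_add_squared)
  qed simp
  then have "invertible_op C"
    by (intro invertible_op_on_symmetric[OF closed_csubspace_UNIV C, of 1]) (simp_all add: form)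
  then have surj: "range C = UNIV" unfolding invertible_op_on_def by (metis UNIV_I surjI)
  have eq: "A x - adj T (T x) = P (C x)" for x
  proof -
    have "P (x + z) = P x + P z" for x z
      using bounded_P by (simp add: bounded_op_on_def)
    then show ?thesis by (simp add: A_def C_def P_adj_R)
  qed
  have "range (\<lambda>x. P (C x)) = P ` range C" by (simp only: image_image)
  then show ?thesis by (simp only: eq surj)
qed

end


section \<open>The lifting\<close>

context quasi_expansive
begin

definition V :: "'a \<Rightarrow> 'a ell2" where
  "V h = ell2_Cons 0 (ell2_Cons h 0)"

text \<open>The entry \<open>R h\<close> stands in front of \<open>T h\<close> so that the entries from \<open>P h\<close> on are a plain shift,
  under which nothing happens to norms.\<close>

definition S :: "'a ell2 \<Rightarrow> 'a ell2" where
  "S f = (let h = ell2_nth f 1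
          in ell2_Cons (R h) (ell2_Cons (T h) (ell2_Cons (P h) (ell2_tl (ell2_tl f)))))"

definition K :: "'a ell2 set" where
  "K = closed_csubspace hull (\<Union>n. (S ^^ n) ` range V)"

lemma closed_K: "closed_csubspace K"
  unfolding K_def by (rule closed_csubspace_hull)

lemma S_components:
  "ell2_nth (S f) 0 = R (ell2_nth f 1)" "ell2_nth (S f) 1 = T (ell2_nth f 1)"
  "ell2_nth (S f) 2 = P (ell2_nth f 1)"
  "ell2_tl (ell2_tl (S f)) = ell2_Cons (P (ell2_nth f 1)) (ell2_tl (ell2_tl f))"
  unfolding S_def Let_def ell2_tl_Cons by (transfer; simp add: eval_nat_numeral)+

lemma cinner_S:
  "cinner (S f) (S g) = cinner (A (ell2_nth f 1)) (ell2_nth g 1)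
    + cinner (ell2_tl (ell2_tl f)) (ell2_tl (ell2_tl g))"
  by (simp add: S_def Let_def cinner_ell2_split[of "ell2_Cons _ _"] cinner_A)

text \<open>This is \<open>T\<^sup>*A T + P = A\<close>, read through the inner product formula for \<open>S\<close>.\<close>

lemma quasi_isometry_S: "cinner (S (S f)) (S (S g)) = cinner (S f) (S g)"
  using cinner_A_T[of "ell2_nth f 1" "ell2_nth g 1"]
  unfolding cinner_S[of "S f" "S g"] S_components
  by (simp add: cinner_S cinner_ell2_split[of "ell2_Cons _ _"] flip: add.assoc)

lemma cinner_V: "cinner f (V h) = cinner (ell2_nth f 1) h"
  by (simp add: V_def cinner_ell2_split[of f] cinner_ell2_split[of "ell2_tl f"] ell2_hd_tl)

lemma V_components: "ell2_nth (V h) 0 = 0" "ell2_nth (V h) 1 = h" "ell2_nth (V h) 2 = 0"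
  "ell2_tl (ell2_tl (V h)) = 0"
  unfolding V_def ell2_tl_Cons by (transfer; simp add: eval_nat_numeral)+

lemma isometric_embedding_V: "isometric_embedding V UNIV"
  unfolding isometric_embedding_def
proof (intro conjI allI subset_UNIV)
  show "V (x + y) = V x + V y" for x y by (simp add: V_def flip: ell2_Cons_add)
  show "V (c *\<^sub>C x) = c *\<^sub>C V x" for c x by (simp add: V_def flip: ell2_Cons_scaleC)
  have "cinner (V x) (V x) = cinner x x" for x by (simp only: cinner_V V_components)
  then have "(norm (V x))\<^sup>2 = (norm x)\<^sup>2" for x by (metis Re_cinner_self)
  then show "norm (V x) = norm x" for x by (simp add: power2_eq_iff_nonneg)
qed

lemma bounded_S: "bounded_op S"
proof -
  obtain M where M: "\<And>x. norm (A x) \<le> M * norm x" "0 < M"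
    using bounded_op_on_bound[OF bounded_A] by auto
  have "norm (S f) \<le> sqrt (M + 1) * norm f" for f
  proof (rule power2_le_imp_le)
    have h: "norm (ell2_nth f 1) \<le> norm f" by (rule norm_ell2_nth_le)
    have "(norm (S f))\<^sup>2 = Re (cinner (A (ell2_nth f 1)) (ell2_nth f 1)) + (norm (ell2_tl (ell2_tl f)))\<^sup>2"
      using arg_cong[OF cinner_S[of f f], of Re] by (simp add: Re_cinner_self)
    also have "Re (cinner (A (ell2_nth f 1)) (ell2_nth f 1)) \<le> norm (A (ell2_nth f 1)) * norm (ell2_nth f 1)"
      by (rule order_trans[OF complex_Re_le_cmod cinner_Cauchy_Schwarz])
    also have "\<dots> \<le> (M * norm f) * norm f"
      using M h by (intro mult_mono order_trans[OF M(1)] mult_left_mono) auto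
    also have "(norm (ell2_tl (ell2_tl f)))\<^sup>2 \<le> (norm f)\<^sup>2"
      using norm_ell2_tl_le[of "ell2_tl f"] norm_ell2_tl_le[of f] by (intro power_mono) auto
    finally have "(norm (S f))\<^sup>2 \<le> M * (norm f)\<^sup>2 + (norm f)\<^sup>2"
      by (simp add: power2_eq_square mult.assoc)
    then show "(norm (S f))\<^sup>2 \<le> (sqrt (M + 1) * norm f)\<^sup>2"
      using M(2) by (simp add: power_mult_distrib distrib_right)
  qed (use M(2) in simp)
  moreover have "S (f + g) = S f + S g" for f g
    using T bounded_P bounded_R
    by (simp add: S_def Let_def bounded_op_on_def ell2_nth_add ell2_tl_add flip: ell2_Cons_add)
  moreover have "S (c *\<^sub>C f) = c *\<^sub>C S f" for c f
    using T bounded_P bounded_R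
    by (simp add: S_def Let_def bounded_op_on_def ell2_nth_scaleC ell2_tl_scaleC flip: ell2_Cons_scaleC)
  ultimately show ?thesis by (auto simp: bounded_op_on_def)
qed

lemma V_in_K: "V h \<in> K"
proof -
  have "V h \<in> (S ^^ 0) ` range V" by simp
  then show ?thesis unfolding K_def by (intro hull_inc UN_I[of 0]) auto
qed

lemma S_in_K:
  assumes "f \<in> K"
  shows "S f \<in> K"
proof -
  have "(S ^^ n) (V h) \<in> S -` K" for n h
  proof -
    have "(S ^^ Suc n) (V h) \<in> (\<Union>n. (S ^^ n) ` range V)" by blast
    then show ?thesis unfolding K_def by (simp add: hull_inc)
  qed
  then have "K \<subseteq> S -` K"
    unfolding K_def[THEN arg_cong, of "\<lambda>X. X \<subseteq> S -` K"]
    by (intro hull_minimal closed_csubspace_vimage bounded_S closed_K) auto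
  with assms show ?thesis by blast
qed

text \<open>The condition is closed and linear, it holds for \<open>(0, h, 0, \<dots>)\<close>, and it holds for every value
  of \<open>S\<close> because \<open>R P = R\<close>.\<close>

lemma K_first_component:
  assumes "f \<in> K"
  shows "ell2_nth f 0 = R (ell2_nth f 2)"
proof -
  define X where "X = {f :: 'a ell2. ell2_nth f 0 - R (ell2_nth f 2) = 0}"
  have "bounded_linear (\<lambda>f. ell2_nth f 0 - R (ell2_nth f 2))"
    by (intro bounded_linear_sub bounded_linear_ell2_nth
        bounded_linear_compose[OF bounded_op_linear[OF bounded_R]])
  then have "closed_csubspace X"
    unfolding X_def using bounded_R
    by (intro closed_csubspace_eq_zero) (auto simp: ell2_nth_scaleC bounded_op_on_def)
  moreover have "(S ^^ n) (V h) \<in> X" for n h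
  proof (cases n)
    case 0
    have "R 0 = 0" by (rule linear_0[OF bounded_linear.linear[OF bounded_op_linear[OF bounded_R]]])
    then show ?thesis by (simp add: 0 X_def V_components)
  next
    case (Suc k)
    then show ?thesis by (simp add: X_def S_components R_P)
  qed
  ultimately have "K \<subseteq> X" unfolding K_def by (intro hull_minimal) auto
  with assms show ?thesis by (auto simp: X_def)
qed

lemma bounded_op_S_K: "bounded_op_on K S"
  by (rule bounded_op_on_subset[OF bounded_S S_in_K])

text \<open>Only the first entry of \<open>f\<close> is lost under \<open>S\<close>, and on \<open>K\<close> it is controlled by the third one.\<close>

lemma S_bounded_below:
  obtains m where "0 < m" "\<And>f. f \<in> K \<Longrightarrow> m * norm f \<le> norm (S f)"
proof -
  obtain M where M: "\<And>x. norm (R x) \<le> M * norm x" "0 < M"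
    using bounded_op_on_bound[OF bounded_R] by auto
  have "norm f \<le> sqrt (M\<^sup>2 + 1) * norm (S f)" if "f \<in> K" for f
  proof (rule power2_le_imp_le)
    define w where "w = ell2_tl (ell2_tl f)"
    have "ell2_nth f 2 = ell2_hd w" unfolding w_def by transfer (simp add: eval_nat_numeral)
    then have "norm (ell2_nth f 0) \<le> M * norm (ell2_hd w)"
      using M(1) by (simp add: K_first_component[OF that])
    also have "\<dots> \<le> M * norm w"
      using M(2) by (intro mult_left_mono norm_ell2_nth_le) simp
    finally have "(norm (ell2_nth f 0))\<^sup>2 \<le> (M * norm w)\<^sup>2" by (rule power_mono) simp
    moreover have "(norm f)\<^sup>2 = (norm (ell2_nth f 0))\<^sup>2 + (norm (ell2_nth f 1))\<^sup>2 + (norm w)\<^sup>2"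
      using norm_ell2_split[of f] norm_ell2_split[of "ell2_tl f"] by (simp add: ell2_hd_tl w_def)
    moreover have below: "(norm (ell2_nth f 1))\<^sup>2 + (norm w)\<^sup>2 \<le> (norm (S f))\<^sup>2"
      using arg_cong[OF cinner_S[of f f], of Re] A_coercive[of "ell2_nth f 1"]
      by (simp add: Re_cinner_self w_def)
    moreover have "M\<^sup>2 * (norm w)\<^sup>2 \<le> M\<^sup>2 * (norm (S f))\<^sup>2"
      by (intro mult_left_mono order_trans[OF _ below]) auto
    ultimately show "(norm f)\<^sup>2 \<le> (sqrt (M\<^sup>2 + 1) * norm (S f))\<^sup>2"
      by (simp add: power_mult_distrib distrib_right)
  qed simp
  moreover have "0 < sqrt (M\<^sup>2 + 1)" by (simp add: add_nonneg_pos)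
  ultimately show ?thesis
    using that[of "1 / sqrt (M\<^sup>2 + 1)"] by (simp add: field_simps)
qed

lemma similar_to_isometry_S: "similar_to_isometry_on K S"
proof -
  have "norm (S (S f)) = norm (S f)" for f
    using arg_cong[OF quasi_isometry_S[of f f], of Re] by (simp add: Re_cinner_self power2_eq_iff_nonneg)
  then show ?thesis
    using S_bounded_below bounded_below_similar_to_isometry[OF closed_K bounded_op_S_K] by metis
qed

lemma proj_V: "proj V k = ell2_nth k 1"
  unfolding proj_def
proof (rule the_equality)
  have eq: "cinner (k - V h) (V x) = cinner (ell2_nth k 1 - h) x" for h x
    by (subst (1 2) cinner.diff_left) (simp only: cinner_V V_components)
  show "\<forall>x. cinner (k - V (ell2_nth k 1)) (V x) = 0" by (simp only: eq) simp
  fix h assume "\<forall>x. cinner (k - V h) (V x) = 0"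
  then have "cinner (ell2_nth k 1 - h) (ell2_nth k 1 - h) = 0" by (simp only: eq)
  then show "h = ell2_nth k 1" by (simp only: cinner_self_eq_0) simp
qed

lemma natural_quasi_isometric_lifting_S: "natural_quasi_isometric_lifting V K S T"
  unfolding natural_quasi_isometric_lifting_def
proof (intro conjI K_def)
  have "isometric_embedding V K"
    using isometric_embedding_V V_in_K by (auto simp: isometric_embedding_def)
  then show "lifting V K S T"
    unfolding lifting_def proj_V S_components by (simp add: closed_K bounded_op_S_K)
  show "quasi_isometric_on K S"
    unfolding quasi_isometric_on_def
  proof (intro conjI ballI bounded_op_S_K)
    note adj = adj_on_in[OF closed_K bounded_op_S_K] cinner_adj_on[OF closed_K bounded_op_S_K]
    fix f assume f: "f \<in> K"
    have "adj_on K S (adj_on K S (S (S f))) = adj_on K S (S f)"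
      by (rule adj_on_eqI[OF closed_K]) (simp_all add: adj S_in_K quasi_isometry_S flip: adj(2))
    then show "(adj_on K S ^^ 2) ((S ^^ 2) f) = adj_on K S (S f)" by (simp add: numeral_2_eq_2)
  qed
  have "adj_on K S (S (V h)) = V (A h)" for h
  proof (rule adj_on_eqI[OF closed_K V_in_K])
    fix g
    show "cinner (S g) (S (V h)) = cinner g (V (A h))"
      unfolding cinner_S V_components cinner_V by (simp add: A_symmetric)
  qed
  then show "(\<lambda>k. adj_on K S (S k)) ` range V \<subseteq> range V" by auto
qed

end

section \<open>Existence of the operator and of the lifting\<close>

theorem theorem3p8:
  fixes T :: "'a::complex_hilbert \<Rightarrow> 'a"
  assumes "bounded_op T"
    and "adj T \<circ> T \<le>\<^sub>o\<^sub>p (adj T ^^ 2) \<circ> (T ^^ 2)"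
    and "(adj T ^^ 2) \<circ> (T ^^ 2) = (adj T ^^ 3) \<circ> (T ^^ 3)"
    and "(adj T \<circ> T) ` op_kernel (adj T) \<subseteq> op_kernel (adj T)"
  shows "(\<exists>A. invertible_op A \<and>
              adj T \<circ> T \<le>\<^sub>o\<^sub>p adj T \<circ> A \<circ> T \<and>
              adj T \<circ> A \<circ> T \<le>\<^sub>o\<^sub>p A \<and>
              range (\<lambda>x. A x - adj T (T x)) = range (\<lambda>x. A x - adj T (A (T x))) \<and>
              closed (range (\<lambda>x. A x - adj T (T x)))) \<and>
         (\<exists>(V :: 'a \<Rightarrow> 'a ell2) K S.
              natural_quasi_isometric_lifting V K S T \<and> similar_to_isometry_on K S)"
proof -
  note T = assms(1)
  note adj = cinner_adj_left[OF T]
  interpret quasi_expansive T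
  proof
    show "bounded_op T" by (rule T)
    fix x
    have "0 \<le> Re (cinner (adj T (adj T (T (T x))) - adj T (T x)) x)"
      using assms(2) by (simp add: op_le_def positive_op_def numeral_2_eq_2 complex_nonneg_Reals_iff)
    then have "(norm (T x))\<^sup>2 \<le> (norm (T (T x)))\<^sup>2"
      by (simp add: cinner.diff_left adj Re_cinner_self)
    then show "norm (T x) \<le> norm (T (T x))" by (rule power2_le_imp_le) simp
    have "adj T (adj T (T (T x))) = adj T (adj T (adj T (T (T (T x)))))"
      using fun_cong[OF assms(3), of x] by (simp add: numeral_2_eq_2 numeral_3_eq_3)
    then have "cinner (T (T x)) (T (T x)) = cinner (T (T (T x))) (T (T (T x)))"
      by (metis adj)
    then have "(norm (T (T (T x))))\<^sup>2 = (norm (T (T x)))\<^sup>2" by (metis Re_cinner_self)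
    then show "norm (T (T (T x))) = norm (T (T x))" by (simp add: power2_eq_iff_nonneg)
  next
    fix n assume "adj T n = 0"
    then show "adj T (adj T (T n)) = 0" using assms(4) by (auto simp: op_kernel_def)
  qed
  have A_ge_1: "cinner (A x) x - cinner x x \<in> \<real>\<^sub>\<ge>\<^sub>0" for x
  proof -
    have "cinner (A x) x = of_real ((norm (T x))\<^sup>2 + (norm (P x))\<^sup>2 + (norm (R x))\<^sup>2)"
      by (simp add: cinner_A cinner_self)
    then show ?thesis using A_coercive[of x] by (simp add: complex_nonneg_Reals_iff cinner_self)
  qed
  have "adj T \<circ> T \<le>\<^sub>o\<^sub>p adj T \<circ> A \<circ> T"
    unfolding op_le_def positive_op_def using A_ge_1[of "T _"] by (simp add: cinner.diff_left adj)
  moreover have "adj T \<circ> A \<circ> T \<le>\<^sub>o\<^sub>p A"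
    unfolding op_le_def positive_op_def
    by (simp add: A_minus_adj_T_A_T cinner_P(1)[of x x for x] cinner_self)
  moreover have "range (\<lambda>x. A x - adj T (T x)) = range (\<lambda>x. A x - adj T (A (T x)))"
    by (simp only: range_A_minus_adj_T_T A_minus_adj_T_A_T)
  moreover have "closed (range (\<lambda>x. A x - adj T (T x)))"
    unfolding range_A_minus_adj_T_T range_P by (rule closed_csubspaceD(6)[OF kernel_P])
  ultimately show ?thesis
    using invertible_A natural_quasi_isometric_lifting_S similar_to_isometry_S by blast
qed

end
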